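(* Let $\mathcal{H}\in C^\omega(\mathbb{S}^2)$ and let $\beta,B:I\to\mathbb{R}^3$ be a pair of Björling data defined on an open real interval $I$. Then there exist an open domain $\Omega\subset\mathbb{C}$ containing $I\times\{0\}$ and a conformal immersion $\psi:\Omega\to\mathbb{R}^3$, $z=s+it$, that solves the system $$\psi_{z\overline{z}}=-i\,\mathcal{H}(\eta)\,\psi_z\wedge\psi_{\overline{z}},\qquad \psi(s,0)=\beta(s),\qquad \psi_t(s,0)=B(s)\quad (s\in I),$$ where $\eta=\frac{2}{i\lambda^2}\psi_z\wedge\psi_{\overline{z}}$ is the unit normal of $\psi$ and $\lambda^2=\langle\psi_s,\psi_s\rangle=\langle\psi_t,\psi_t\rangle$ is the conformal factor. As a consequence, $\psi$ defines an $\mathcal{H}$-surface $\Sigma$ that contains the curve $\beta(s)$, and the tangent plane $T_{\beta(s)}\Sigma$ at each point $\beta(s)$ is spanned by $\beta'(s)$ and $B(s)$.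
   Context: $C^\omega(\mathbb{S}^2)$ denotes the real-analytic functions on the unit sphere $\mathbb{S}^2\subset\mathbb{R}^3$. A pair of Björling data on an open interval $I\subset\mathbb{R}$ is a regular real-analytic curve $\beta:I\to\mathbb{R}^3$ together with a real-analytic vector field $B:I\to\mathbb{R}^3$ along $\beta$ such that $|\beta'(s)|=|B(s)|$ and $\langle\beta'(s),B(s)\rangle=0$ for all $s\in I$. Given $\mathcal{H}\in C^1(\mathbb{S}^2)$, an oriented immersed surface $\Sigma$ in $\mathbb{R}^3$ with Gauss map $\eta:\Sigma\to\mathbb{S}^2$ is an $\mathcal{H}$-surface if its mean curvature (computed with respect to $\eta$) satisfies $H_\Sigma(p)=\mathcal{H}(\eta_p)$ for all $p\in\Sigma$. Wirtinger operators: $\partial_z=\frac12(\partial_s-i\partial_t)$, $\partial_{\overline z}=\frac12(\partial_s+i\partial_t)$; $\wedge$ is the cross product extended complex-bilinearly. *)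

theory Defs
  imports "HOL-Analysis.Analysis" "HOL-Analysis.Cross3"
begin

definition real_analytic_on3 :: "(real^3) set \<Rightarrow> (real^3 \<Rightarrow> real) \<Rightarrow> bool" where
  "real_analytic_on3 U g \<longleftrightarrow>
     (\<forall>p\<in>U. \<exists>r>0. \<exists>c :: nat \<Rightarrow> nat \<Rightarrow> nat \<Rightarrow> real.
        \<forall>x\<in>ball p r.
          ((\<lambda>(i,j,k). c i j k * (x$1 - p$1)^i * (x$2 - p$2)^j * (x$3 - p$3)^k)
             has_sum g x) UNIV)"

definition sphere2 :: "(real^3) set" where
  "sphere2 = sphere 0 1"

definition analytic_on_S2 :: "(real^3 \<Rightarrow> real) \<Rightarrow> bool" where
  "analytic_on_S2 H \<longleftrightarrow>
     (\<exists>U g. open U \<and> sphere2 \<subseteq> U \<and> real_analytic_on3 U g \<and> (\<forall>p\<in>sphere2. g p = H p))"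

definition real_analytic_curve :: "real set \<Rightarrow> (real \<Rightarrow> real^3) \<Rightarrow> bool" where
  "real_analytic_curve I f \<longleftrightarrow>
     (\<forall>s\<in>I. \<exists>r>0. \<exists>c :: nat \<Rightarrow> real^3.
        \<forall>x\<in>ball s r. (\<lambda>n. (x - s)^n *\<^sub>R c n) sums f x)"

definition bjorling_data :: "real set \<Rightarrow> (real \<Rightarrow> real^3) \<Rightarrow> (real \<Rightarrow> real^3) \<Rightarrow> bool" where
  "bjorling_data I \<beta> B \<longleftrightarrow>
     real_analytic_curve I \<beta> \<and> real_analytic_curve I B \<and>
     (\<forall>s\<in>I. vector_derivative \<beta> (at s) \<noteq> 0 \<and>
             norm (vector_derivative \<beta> (at s)) = norm (B s) \<and>
             vector_derivative \<beta> (at s) \<bullet> B s = 0)"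

definition d_s :: "(complex \<Rightarrow> 'a::real_normed_vector) \<Rightarrow> complex \<Rightarrow> 'a" where
  "d_s f z = vector_derivative (\<lambda>s. f (z + complex_of_real s)) (at 0)"

definition d_t :: "(complex \<Rightarrow> 'a::real_normed_vector) \<Rightarrow> complex \<Rightarrow> 'a" where
  "d_t f z = vector_derivative (\<lambda>t. f (z + \<i> * complex_of_real t)) (at 0)"

definition C2_on :: "complex set \<Rightarrow> (complex \<Rightarrow> 'a::real_normed_vector) \<Rightarrow> bool" where
  "C2_on \<Omega> f \<longleftrightarrow>
     (\<forall>z\<in>\<Omega>. f differentiable (at z) \<and> d_s f differentiable (at z) \<and> d_t f differentiable (at z)) \<and>
     continuous_on \<Omega> (d_s (d_s f)) \<and> continuous_on \<Omega> (d_s (d_t f)) \<and>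
     continuous_on \<Omega> (d_t (d_s f)) \<and> continuous_on \<Omega> (d_t (d_t f))"

definition cvec :: "real^3 \<Rightarrow> complex^3" where
  "cvec v = (\<chi> i. complex_of_real (v $ i))"

definition rvec :: "complex^3 \<Rightarrow> real^3" where
  "rvec v = (\<chi> i. Re (v $ i))"

definition wz :: "(complex \<Rightarrow> complex^3) \<Rightarrow> complex \<Rightarrow> complex^3" where
  "wz f z = (1/2 :: complex) *s (d_s f z - \<i> *s d_t f z)"

definition wzb :: "(complex \<Rightarrow> complex^3) \<Rightarrow> complex \<Rightarrow> complex^3" where
  "wzb f z = (1/2 :: complex) *s (d_s f z + \<i> *s d_t f z)"

definition ccross :: "complex^3 \<Rightarrow> complex^3 \<Rightarrow> complex^3" where
  "ccross a b = vector [a$2 * b$3 - a$3 * b$2,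
                        a$3 * b$1 - a$1 * b$3,
                        a$1 * b$2 - a$2 * b$1]"

definition conf_factor :: "(complex \<Rightarrow> real^3) \<Rightarrow> complex \<Rightarrow> real" where
  "conf_factor \<psi> z = d_s \<psi> z \<bullet> d_s \<psi> z"

definition conformal_immersion_on :: "complex set \<Rightarrow> (complex \<Rightarrow> real^3) \<Rightarrow> bool" where
  "conformal_immersion_on \<Omega> \<psi> \<longleftrightarrow>
     C2_on \<Omega> \<psi> \<and>
     (\<forall>z\<in>\<Omega>. d_s \<psi> z \<bullet> d_s \<psi> z = d_t \<psi> z \<bullet> d_t \<psi> z \<and>
             d_s \<psi> z \<bullet> d_t \<psi> z = 0 \<and>
             d_s \<psi> z \<bullet> d_s \<psi> z > 0)"

text \<open>eta = 2/(i lambda^2) psi_z wedge psi_zbar (a real vector; we take real parts).\<close>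
definition unit_normal :: "(complex \<Rightarrow> real^3) \<Rightarrow> complex \<Rightarrow> real^3" where
  "unit_normal \<psi> z =
     rvec ((2 / (\<i> * complex_of_real (conf_factor \<psi> z))) *s
           ccross (wz (cvec \<circ> \<psi>) z) (wzb (cvec \<circ> \<psi>) z))"

definition mean_curvature :: "(complex \<Rightarrow> real^3) \<Rightarrow> (complex \<Rightarrow> real^3) \<Rightarrow> complex \<Rightarrow> real" where
  "mean_curvature \<psi> \<eta> z =
     (let E = d_s \<psi> z \<bullet> d_s \<psi> z; F = d_s \<psi> z \<bullet> d_t \<psi> z; G = d_t \<psi> z \<bullet> d_t \<psi> z;
          e = d_s (d_s \<psi>) z \<bullet> \<eta> z; f = d_s (d_t \<psi>) z \<bullet> \<eta> z; g = d_t (d_t \<psi>) z \<bullet> \<eta> z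
      in (e * G - 2 * f * F + g * E) / (2 * (E * G - F^2)))"

end

(* Put p = psi_z.  The equation becomes dp/dzbar = F(p, cnj p) with
   F(P, Q) = -i G(P x Q / (i P.Q)) P x Q, where G is a holomorphic extension of H; the right-hand
   side is real, so that p is the z-derivative of a real map.  Treating z and w = zbar as independent
   complex variables turns the Cauchy problem into
     P(z, w) = p0(z) + int_z^w F(P(z, x), cnj (P(cnj x, cnj z))) dx,
   where p0 extends (beta' - i B)/2 holomorphically.  In these characteristic coordinates no derivative
   is lost, so that Picard iteration converges in the sup norm near the diagonal, and
   p(z) = P(z, cnj z).  Finally p.p is holomorphic and vanishes on the curve, which gives conformality. *)

theory Submission
  imports Defs "HOL-Complex_Analysis.Complex_Analysis"
begin

unbundle no Formal_Power_Series.fps_syntax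

section \<open>Holomorphic dependence on parameters\<close>

text \<open>Conformality is available only after the equation has been solved, so the right-hand
  side must make sense for non-conformal p as well. For this reason lambda^2 is replaced by 2 P.Q,
  which agrees with it in the conformal case. Otherwise P x Q / (i P.Q) need not have unit length,
  and H has to be extended to a full neighbourhood of the sphere. The choice pays off because P.(P x
  Q) = 0 whatever the scalar factor, which makes the zbar-derivative of p.p vanish identically. The
  radii of convergence may shrink to zero towards the ends of I. The Picard operator, however,
  mentions neither a radius nor a centre: it acts on each product of two squares separately, because
  these products are compatible with the segments from z to w and with the reflection (z, w) -> (cnj
  w, cnj z). One fixed point therefore serves all squares. F is only ever composed with maps of one
  complex variable, so holomorphy is tested along curves and complex lines throughout.\<close>

lemma continuous_on_deriv_parametric:
  fixes f :: "complex \<Rightarrow> 'a::metric_space \<Rightarrow> complex"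
  assumes "open S" and cont: "continuous_on (S \<times> T) (\<lambda>(z, t). f z t)"
    and hol: "\<And>t. t \<in> T \<Longrightarrow> (\<lambda>z. f z t) holomorphic_on S"
  shows "continuous_on (S \<times> T) (\<lambda>(z, t). deriv (\<lambda>z. f z t) z)"
  unfolding continuous_on_eq_continuous_within
proof
  fix p assume "p \<in> S \<times> T"
  then obtain z0 t0 where p: "p = (z0, t0)" "z0 \<in> S" "t0 \<in> T" by auto
  obtain r where r: "r > 0" "cball z0 r \<subseteq> S"
    using \<open>open S\<close> p(2) open_contains_cball by blast
  let ?U = "ball z0 r \<times> T"
  let ?g = "\<lambda>x. circlepath z0 r x"
  have gS: "?g x \<in> S" and gne: "?g x \<noteq> w" if "w \<in> ball z0 r" for x w
  proof -
    have "?g x \<in> sphere z0 r"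
      using r(1) by (simp add: circlepath dist_norm norm_mult)
    then show "?g x \<in> S" "?g x \<noteq> w" using r that by (auto simp: subset_iff)
  qed
  \<comment> \<open>Cauchy's formula over one fixed circle about \<open>z0\<close> turns the
    derivative into an integral over [0,1]. Its integrand contains \<open>f\<close> but no
    derivative of \<open>f\<close>, and is jointly continuous in \<open>w\<close>, \<open>t\<close>
    and the integration variable.\<close>
  have eq: "deriv (\<lambda>z. f z t) w = 1 / (2 * of_real pi * \<i>) *
      integral (cbox 0 1) (\<lambda>x. f (?g x) t / (?g x - w)^2 * (2 * pi * \<i> * r * exp (2 * of_real pi * \<i> * x)))"
    if "(w, t) \<in> ?U" for w t
  proof -
    have h: "(\<lambda>z. f z t) holomorphic_on S" using that hol by auto
    have "continuous_on (cball z0 r) (\<lambda>z. f z t)" "(\<lambda>z. f z t) holomorphic_on ball z0 r"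
      using h r holomorphic_on_imp_continuous_on holomorphic_on_subset
      by (meson ball_subset_cball dual_order.trans)+
    from Cauchy_derivative_integral_circlepath(2)[OF this, of w] that
    have "deriv (\<lambda>z. f z t) w = 1 / (2 * of_real pi * \<i>) * contour_integral (circlepath z0 r) (\<lambda>u. f u t / (u - w)^2)"
      by (auto intro: DERIV_imp_deriv)
    then show ?thesis
      by (simp add: contour_integral_integral vector_derivative_circlepath)
  qed
  have cf: "continuous_on (?U \<times> cbox 0 1) (\<lambda>x. f (?g (snd x)) (snd (fst x)))"
  proof -
    have "continuous_on (?U \<times> cbox 0 (1::real)) (\<lambda>x. (\<lambda>(z, t). f z t) (?g (snd x), snd (fst x)))"
    proof (rule continuous_on_compose2[OF cont])
      show "continuous_on (?U \<times> cbox 0 1) (\<lambda>x. (circlepath z0 r (snd x), snd (fst x)))"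
        by (auto simp: circlepath intro!: continuous_intros)
      show "(\<lambda>x. (circlepath z0 r (snd x), snd (fst x))) ` (?U \<times> cbox 0 1) \<subseteq> S \<times> T"
        using gS by auto
    qed
    then show ?thesis by simp
  qed
  have "continuous_on ?U (\<lambda>q. integral (cbox 0 1)
      (\<lambda>x. f (?g x) (snd q) / (?g x - fst q)^2 * (2 * pi * \<i> * r * exp (2 * of_real pi * \<i> * x))))"
  proof (rule integral_continuous_on_param)
    show "continuous_on (?U \<times> cbox 0 1) (\<lambda>(q, x). f (?g x) (snd q) / (?g x - fst q)^2 *
        (2 * pi * \<i> * r * exp (2 * of_real pi * \<i> * x)))"
      unfolding case_prod_unfold
    proof (intro continuous_on_mult continuous_on_divide cf)
      show "\<forall>x\<in>?U \<times> cbox 0 1. (circlepath z0 r (snd x) - fst (fst x))\<^sup>2 \<noteq> 0"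
        using gne by auto
    qed (auto simp: circlepath intro!: continuous_intros)
  qed
  then have "continuous_on ?U (\<lambda>q. 1 / (2 * of_real pi * \<i>) * integral (cbox 0 1)
      (\<lambda>x. f (?g x) (snd q) / (?g x - fst q)^2 * (2 * pi * \<i> * r * exp (2 * of_real pi * \<i> * x))))"
    by (intro continuous_on_mult continuous_on_const)
  then have "continuous_on ?U (\<lambda>(z, t). deriv (\<lambda>z. f z t) z)"
    by (rule continuous_on_eq) (auto simp: eq)
  then have "continuous (at p within ?U) (\<lambda>(z, t). deriv (\<lambda>z. f z t) z)"
    using p r(1) by (auto simp: continuous_on_eq_continuous_within)
  moreover have "at p within ?U = at p within S \<times> T"
    by (rule at_within_nhd[where S="ball z0 r \<times> UNIV"])
       (use p r in \<open>auto intro!: open_Times simp: subset_iff\<close>)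
  ultimately show "continuous (at p within S \<times> T) (\<lambda>(z, t). deriv (\<lambda>z. f z t) z)"
    by simp
qed

text \<open>Differentiation under the integral sign: the joint continuity of the
  \<open>z\<close>-derivative that Leibniz' rule asks for follows from joint continuity of
  \<open>f\<close> by the preceding lemma.\<close>

lemma holomorphic_on_integral_parametric:
  fixes f :: "complex \<Rightarrow> real \<Rightarrow> complex"
  assumes "open S" "convex S" and cont: "continuous_on (S \<times> {0..1}) (\<lambda>(z, t). f z t)"
    and hol: "\<And>t. t \<in> {0..1} \<Longrightarrow> (\<lambda>z. f z t) holomorphic_on S"
  shows "(\<lambda>z. integral {0..1} (f z)) holomorphic_on S"
proof -
  have "(\<lambda>z. integral (cbox 0 1) (f z)) holomorphic_on S"
  proof (rule leibniz_rule_holomorphic)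
    show "((\<lambda>z. f z t) has_field_derivative deriv (\<lambda>z. f z t) z) (at z within S)"
      if "z \<in> S" "t \<in> cbox 0 1" for z t
      using that hol[of t] assms(1)
      by (simp add: holomorphic_derivI)
    show "f z integrable_on cbox 0 1" if "z \<in> S" for z
    proof (rule integrable_continuous)
      have "continuous_on (cbox 0 1) (\<lambda>t. (\<lambda>(z, t). f z t) (z, t))"
        by (rule continuous_on_compose2[OF cont]) (use that in \<open>auto intro!: continuous_intros\<close>)
      then show "continuous_on (cbox 0 1) (f z)" by simp
    qed
    show "continuous_on (S \<times> cbox 0 1) (\<lambda>(z, t). deriv (\<lambda>z. f z t) z)"
      using continuous_on_deriv_parametric[OF assms(1) cont hol] by simp
  qed fact
  then show ?thesis by simp
qed

text \<open>A weak form of joint holomorphy, which avoids Hartogs and Osgood type theorems.\<close>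

definition holomorphic_along_curves ::
    "((complex^3) \<times> (complex^3)) set \<Rightarrow> ((complex^3) \<times> (complex^3) \<Rightarrow> complex) \<Rightarrow> bool" where
  "holomorphic_along_curves V F \<longleftrightarrow>
     (\<forall>S u v. open S \<longrightarrow> (\<forall>i. (\<lambda>x. u x $ i) holomorphic_on S) \<longrightarrow>
        (\<forall>i. (\<lambda>x. v x $ i) holomorphic_on S) \<longrightarrow> (\<forall>x\<in>S. (u x, v x) \<in> V) \<longrightarrow>
        (\<lambda>x. F (u x, v x)) holomorphic_on S)"

lemma norm_vector_smult: "norm (c *s v) = norm c * norm (v :: complex^'n)"
  by (simp add: norm_vec_def norm_mult L2_set_right_distrib)

lemma norm_Pair_smult: "norm (c *s v, c *s w) = norm c * norm (v :: complex^'n, w :: complex^'m)"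
  by (simp add: norm_Pair norm_vector_smult power_mult_distrib real_sqrt_mult flip: distrib_left)

lemma norm_le_3_componentwise:
  fixes v :: "complex^3"
  assumes "\<And>i. norm (v $ i) \<le> e"
  shows "norm v \<le> 3 * e"
proof -
  have "norm v \<le> (\<Sum>i\<in>UNIV. norm (v $ i))"
    unfolding norm_vec_def by (rule L2_set_le_sum) simp
  also have "\<dots> \<le> 3 * e" using assms[of 1] assms[of 2] assms[of 3] by (simp add: sum_3)
  finally show ?thesis .
qed

text \<open>Cauchy's inequality on the complex line through \<open>x\<close> and \<open>y\<close>: a
  bound for \<open>F\<close> on a ball bounds the derivative along the segment between two points of
  a smaller ball, and hence the difference of the values. These are the two estimates on which the
  Picard iteration rests.\<close>

lemma holomorphic_along_curves_locally_Lipschitz: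
  assumes V: "open V" and cont: "continuous_on V F" and hol: "holomorphic_along_curves V F"
    and c: "c \<in> V"
  obtains r K where "r > 0" "K > 0" "cball c r \<subseteq> V"
    "\<And>x. x \<in> cball c r \<Longrightarrow> norm (F x) \<le> K"
    "\<And>x y. x \<in> cball c r \<Longrightarrow> y \<in> cball c r \<Longrightarrow> norm (F x - F y) \<le> K * norm (x - y)"
proof -
  obtain R where R: "R > 0" "cball c R \<subseteq> V" using V c open_contains_cball by blast
  have "compact (F ` cball c R)"
    using R cont by (meson compact_cball compact_continuous_image continuous_on_subset)
  then obtain M where M: "M > 0" "\<forall>a\<in>F ` cball c R. norm a \<le> M"
    using compact_imp_bounded bounded_pos by blast
  then have M: "M > 0" "\<And>x. x \<in> cball c R \<Longrightarrow> norm (F x) \<le> M" by auto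
  \<comment> \<open>Halving leaves room of width \<open>r\<close> around the segment from
    \<open>y\<close> to \<open>x\<close> for the discs in Cauchy's inequality.\<close>
  define r where "r = R / 2"
  have r: "r > 0" "cball c r \<subseteq> cball c R" using R by (auto simp: r_def)
  define K where "K = max M (M * 2 / r)"
  have lip: "norm (F x - F y) \<le> K * norm (x - y)" if x: "x \<in> cball c r" and y: "y \<in> cball c r" for x y
  proof (cases "x = y")
    case False
    \<comment> \<open>\<open>(u z, v z)\<close> runs through the complex line through
      \<open>y\<close> (at 0) and \<open>x\<close> (at 1). Lengths are scaled by \<open>d\<close>,
      so a disc of radius \<open>r / d\<close> in \<open>z\<close> has radius \<open>r\<close> in
      space.\<close>
    define u where "u = (\<lambda>z. fst y + z *s fst (x - y))"
    define v where "v = (\<lambda>z. snd y + z *s snd (x - y))"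
    define d where "d = norm (x - y)"
    have d: "d > 0" using False by (simp add: d_def)
    have uvr: "(u (of_real t), v (of_real t)) = y + t *\<^sub>R (x - y)" for t
      by (auto simp: u_def v_def prod_eq_iff vec_eq_iff scaleR_conv_of_real[where 'a=complex] algebra_simps)
    have uvd: "norm ((u z, v z) - (u z', v z')) = norm (z - z') * d" for z z'
    proof -
      have "(u z, v z) - (u z', v z') = ((z - z') *s fst (x - y), (z - z') *s snd (x - y))"
        by (simp add: u_def v_def vector_ssub_ldistrib algebra_simps vec_eq_iff)
      moreover have "norm ((z - z') *s fst (x - y), (z - z') *s snd (x - y)) = norm (z - z') * d"
        unfolding norm_Pair_smult d_def by (metis prod.collapse)
      ultimately show ?thesis by simp
    qed
    have cc: "continuous_on UNIV (\<lambda>z. (u z, v z))"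
      unfolding continuous_on_iff dist_norm uvd
    proof (intro ballI allI impI)
      fix z and e :: real assume "e > 0"
      then show "\<exists>\<delta>>0. \<forall>z'\<in>UNIV. cmod (z' - z) < \<delta> \<longrightarrow> cmod (z' - z) * d < e"
        using d by (intro exI[of _ "e / d"]) (auto simp: field_simps)
    qed
    define S where "S = {z. (u z, v z) \<in> ball c R}"
    have oS: "open S"
      unfolding S_def using open_vimage[OF _ cc, of "ball c R"] by (simp add: vimage_def)
    have holS: "(\<lambda>z. F (u z, v z)) holomorphic_on S"
    proof (rule hol[unfolded holomorphic_along_curves_def, rule_format, OF oS])
      show "(\<lambda>z. u z $ i) holomorphic_on S" "(\<lambda>z. v z $ i) holomorphic_on S" for i
        by (auto simp: u_def v_def intro!: holomorphic_intros)
      show "(u z, v z) \<in> V" if "z \<in> S" for z using that R(2) by (auto simp: S_def)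
    qed
    have seg: "(u z, v z) \<in> ball c R" if t: "t \<in> {0..1}" and z: "z \<in> ball (of_real t) (r / d)" for t z
    proof -
      have "y + t *\<^sub>R (x - y) \<in> cball c r"
      proof -
        have "(1 - t) *\<^sub>R y + t *\<^sub>R x \<in> cball c r"
          using t by (intro convexD[OF convex_cball]) (use x y in auto)
        then show ?thesis by (simp add: algebra_simps)
      qed
      moreover have "dist (u (of_real t), v (of_real t)) (u z, v z) < r"
        unfolding dist_norm uvd using z d by (simp add: dist_norm field_simps)
      ultimately have "dist c (u z, v z) < r + r"
        unfolding uvr using dist_triangle_less_add[of c _ r] 
        by (smt (verit) dist_triangle mem_cball)
      then show ?thesis by (simp add: r_def)
    qed
    have der: "norm (deriv (\<lambda>z. F (u z, v z)) (of_real t)) \<le> M * d * 2 / r" if t: "t \<in> {0..1}" for t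
    proof -
      have sub: "cball (of_real t) (r / d / 2) \<subseteq> S"
        using seg[OF t] d r by (auto simp: S_def subset_iff field_simps)
      have "norm ((deriv ^^ 1) (\<lambda>z. F (u z, v z)) (of_real t)) \<le> fact 1 * M / (r / d / 2) ^ 1"
      proof (rule Cauchy_inequality)
        show "(\<lambda>z. F (u z, v z)) holomorphic_on ball (complex_of_real t) (r / d / 2)"
          using holS by (rule holomorphic_on_subset) (use sub ball_subset_cball in blast)
        show "continuous_on (cball (complex_of_real t) (r / d / 2)) (\<lambda>z. F (u z, v z))"
          using holS sub holomorphic_on_imp_continuous_on continuous_on_subset by blast
        show "0 < r / d / 2" using r d by simp
        show "cmod (F (u x, v x)) \<le> M" if "cmod (of_real t - x) = r / d / 2" for x
        proof (rule M(2))
          have "x \<in> S" using sub that by (auto simp: subset_iff dist_norm)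
          then show "(u x, v x) \<in> cball c R" by (auto simp: S_def)
        qed
      qed
      then show ?thesis by (simp add: field_simps)
    qed
    have "norm ((\<lambda>z. F (u z, v z)) 1 - (\<lambda>z. F (u z, v z)) 0) \<le> (M * d * 2 / r) * norm (1 - 0 :: complex)"
    proof (rule field_differentiable_bound[of "closed_segment 0 1"])
      fix z :: complex assume "z \<in> closed_segment 0 1"
      then obtain t where t: "t \<in> {0..1}" "z = of_real t"
        by (auto simp: closed_segment_def scaleR_conv_of_real)
      have "z \<in> S" using seg[OF t(1), of z] r d t(2) by (simp add: S_def)
      then show "((\<lambda>z. F (u z, v z)) has_field_derivative deriv (\<lambda>z. F (u z, v z)) z) (at z within closed_segment 0 1)"
        using holS oS holomorphic_derivI by blast
      show "cmod (deriv (\<lambda>z. F (u z, v z)) z) \<le> M * d * 2 / r"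
        using der t by simp
    qed auto
    moreover have "(u 1, v 1) = x" "(u 0, v 0) = y" using uvr[of 1] uvr[of 0] by simp_all
    ultimately have "norm (F x - F y) \<le> (M * 2 / r) * d" by (simp add: field_simps)
    also have "\<dots> \<le> K * d" using d by (intro mult_right_mono) (auto simp: K_def)
    finally show ?thesis by (simp add: d_def)
  qed simp
  show ?thesis
  proof (rule that[OF r(1) _ _ _ lip])
    show "K > 0" using M(1) by (simp add: K_def)
    show "cball c r \<subseteq> V" using r R by blast
    show "norm (F x) \<le> K" if "x \<in> cball c r" for x
      using M(2)[of x] r that by (auto simp: K_def)
  qed
qed

section \<open>Holomorphic extension of real-analytic functions\<close>

lemma continuous_on_componentwise_vec:
  fixes P :: "'a::topological_space \<Rightarrow> 'b::topological_space ^ 'n"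
  assumes "\<And>i. continuous_on W (\<lambda>q. P q $ i)"
  shows "continuous_on W P"
  using continuous_on_vec_lambda[of W "\<lambda>i q. P q $ i"] assms by simp

lemma holomorphic_on_uniform_limit_open:
  assumes "open S" and hol: "\<And>n. f n holomorphic_on S"
    and ulim: "uniform_limit S f g F" and "F \<noteq> bot"
  shows "g holomorphic_on S"
proof -
  have "\<exists>r>0. g holomorphic_on ball z r" if z: "z \<in> S" for z
  proof -
    obtain r where r: "r > 0" "cball z r \<subseteq> S" using assms(1) z open_contains_cball by blast
    have "g holomorphic_on ball z r"
    proof (rule holomorphic_uniform_limit)
      show "\<forall>\<^sub>F n in F. continuous_on (cball z r) (f n) \<and> f n holomorphic_on ball z r"
        using holomorphic_on_subset[OF hol] r(2) order_trans[OF ball_subset_cball r(2)]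
        by (intro always_eventually allI conjI holomorphic_on_imp_continuous_on) auto
      show "uniform_limit (cball z r) f g F"
        using ulim r(2) by (rule uniform_limit_on_subset)
    qed (use assms in auto)
    then show ?thesis using r by blast
  qed
  then show ?thesis
    using holomorphic_on_open[OF assms(1)] holomorphic_on_open[OF open_ball]
    by (meson centre_in_ball)
qed

text \<open>Identity theorem: the real points near \<open>x0\<close> accumulate at
  \<open>x0\<close>. It makes the local holomorphic extensions consistent, and later carries
  conformality from the curve to the whole surface.\<close>

lemma holomorphic_eq_if_eq_on_reals:
  assumes D: "open D" "connected D" and fg: "f holomorphic_on D" "g holomorphic_on D"
    and x0: "complex_of_real x0 \<in> D" and z: "z \<in> D"
    and e: "e > 0" and eq: "\<And>x. complex_of_real x \<in> D \<Longrightarrow> \<bar>x - x0\<bar> < e \<Longrightarrow> f (of_real x) = g (of_real x)"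
  shows "f z = g z"
proof -
  have "f z - g z = 0"
  proof (rule analytic_continuation[where f = "\<lambda>z. f z - g z" and S = D and \<xi> = "of_real x0"
        and U = "D \<inter> complex_of_real ` {x. \<bar>x - x0\<bar> < e}"])
    show "complex_of_real x0 islimpt D \<inter> complex_of_real ` {x. \<bar>x - x0\<bar> < e}"
      unfolding islimpt_approachable
    proof (intro allI impI)
      fix d :: real assume d: "d > 0"
      obtain r where r: "r > 0" "ball (complex_of_real x0) r \<subseteq> D"
        using D(1) x0 open_contains_ball by blast
      let ?y = "x0 + min (min r d) e / 2"
      have "dist (complex_of_real ?y) (of_real x0) = min (min r d) e / 2"
        using r d e by (simp add: dist_norm)
      moreover have "complex_of_real ?y \<in> complex_of_real ` {x. \<bar>x - x0\<bar> < e}"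
        using r d e by (intro imageI) auto
      moreover have "complex_of_real ?y \<in> D"
        using calculation(1) r d e by (intro subsetD[OF r(2)]) (unfold mem_ball, subst dist_commute, linarith)
      moreover have "complex_of_real ?y \<noteq> of_real x0" using r d e by simp
      ultimately show "\<exists>x'\<in>D \<inter> complex_of_real ` {x. \<bar>x - x0\<bar> < e}. x' \<noteq> complex_of_real x0 \<and> dist x' (complex_of_real x0) < d"
        using r d e by (intro bexI[of _ "complex_of_real ?y"] IntI conjI) linarith+
    qed
  qed (use assms in \<open>auto intro!: holomorphic_intros\<close>)
  then show ?thesis by simp
qed

text \<open>The same coefficients define a holomorphic function on a disc about each
  \<open>s\<close>. Two discs centred on the real axis meet in a convex set that contains
  \<open>Re z\<close> along with each of its points \<open>z\<close>, so the identity theorem glues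
  the local functions.\<close>

lemma real_analytic_holomorphic_extension:
  fixes f :: "real \<Rightarrow> real"
  assumes "\<forall>s\<in>I. \<exists>r>0. \<exists>c. \<forall>x\<in>ball s r. (\<lambda>n. (x - s) ^ n * c n) sums f x"
  obtains N g where "open N" "complex_of_real ` I \<subseteq> N" "g holomorphic_on N"
    "\<And>x. complex_of_real x \<in> N \<Longrightarrow> g (of_real x) = of_real (f x)"
proof -
  have "\<exists>r h. r > 0 \<and> h holomorphic_on ball (of_real s) r \<and>
      (\<forall>x. complex_of_real x \<in> ball (of_real s) r \<longrightarrow> h (of_real x) = of_real (f x))" if s: "s \<in> I" for s
  proof -
    obtain r c where r: "r > 0" and c: "\<And>x. x \<in> ball s r \<Longrightarrow> (\<lambda>n. (x - s) ^ n * c n) sums f x"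
      using assms s by blast
    have sm: "summable (\<lambda>n. of_real (c n) * (z - of_real s) ^ n)" if z: "z \<in> ball (complex_of_real s) r" for z
    proof -
      \<comment> \<open>A radius strictly between the distance of \<open>z\<close> and
        \<open>r\<close>: convergence at the real point \<open>s + t\<close> forces convergence in
        the open complex disc of radius \<open>t\<close>.\<close>
      define t where "t = (norm (z - of_real s) + r) / 2"
      have t: "norm (z - of_real s) < t" "t < r" "t > 0"
        using z r by (auto simp: t_def dist_norm norm_minus_commute) (smt (verit) norm_ge_zero)
      have "summable (\<lambda>n. t ^ n * c n)" using c[of "s + t"] t by (auto simp: dist_norm sums_iff)
      then have "summable (\<lambda>n. complex_of_real (t ^ n * c n))" by (simp only: summable_of_real)
      then have "summable (\<lambda>n. complex_of_real (c n) * (of_real t) ^ n)" by (simp add: mult.commute)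
      then show ?thesis by (rule powser_inside) (use t in simp)
    qed
    define h :: "complex \<Rightarrow> complex" where "h = (\<lambda>z. \<Sum>n. of_real (c n) * (z - of_real s) ^ n)"
    have "h holomorphic_on ball (of_real s) r"
      by (rule power_series_holomorphic[where a = "\<lambda>n. of_real (c n)"])
         (use sm in \<open>simp add: h_def summable_sums\<close>)
    moreover have "h (of_real x) = of_real (f x)" if "complex_of_real x \<in> ball (of_real s) r" for x
    proof -
      have "x \<in> ball s r" using that by (simp add: dist_of_real)
      from sums_of_real[OF c[OF this], where 'a = complex]
      show ?thesis by (simp add: h_def sums_iff mult.commute)
    qed
    ultimately show ?thesis using r by blast
  qed
  then obtain r h where r: "\<And>s. s \<in> I \<Longrightarrow> r s > 0"
    and hol: "\<And>s. s \<in> I \<Longrightarrow> h s holomorphic_on ball (of_real s) (r s)"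
    and hf: "\<And>s x. s \<in> I \<Longrightarrow> complex_of_real x \<in> ball (of_real s) (r s) \<Longrightarrow> h s (of_real x) = of_real (f x)"
    by metis
  define N where "N = (\<Union>s\<in>I. ball (complex_of_real s) (r s))"
  define k where "k z = (SOME s. s \<in> I \<and> z \<in> ball (complex_of_real s) (r s))" for z
  define g where "g z = h (k z) z" for z
  have k: "k z \<in> I" "z \<in> ball (complex_of_real (k z)) (r (k z))" if "z \<in> N" for z
    using someI_ex[of "\<lambda>s. s \<in> I \<and> z \<in> ball (complex_of_real s) (r s)"] that
    by (auto simp: N_def k_def)
  have re: "of_real (Re z) \<in> ball (complex_of_real s) (r s)" if "z \<in> ball (complex_of_real s) (r s)" for z s
  proof -
    have "\<bar>s - Re z\<bar> \<le> norm (of_real s - z)" using abs_Re_le_cmod[of "of_real s - z"] by simp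
    then show ?thesis using that by (simp add: dist_norm flip: of_real_diff)
  qed
  have gh: "g z = h s z" if s: "s \<in> I" and z: "z \<in> ball (complex_of_real s) (r s)" for s z
  proof -
    have zN: "z \<in> N" using s z by (auto simp: N_def)
    let ?D = "ball (complex_of_real s) (r s) \<inter> ball (complex_of_real (k z)) (r (k z))"
    have "h s z = h (k z) z"
    proof (rule holomorphic_eq_if_eq_on_reals[of ?D "h s" "h (k z)" "Re z" _ 1])
      show "connected ?D" by (intro convex_connected convex_Int convex_ball)
      show "h s holomorphic_on ?D" "h (k z) holomorphic_on ?D"
        using hol[OF s] hol[OF k(1)[OF zN]] by (auto elim: holomorphic_on_subset)
    qed (use z k[OF zN] re[OF z] re[OF k(2)[OF zN]] s hf in auto)
    then show ?thesis by (simp add: g_def)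
  qed
  have "g holomorphic_on N"
  proof -
    have "g holomorphic_on ball (of_real s) (r s)" if "s \<in> I" for s
      using holomorphic_transform[OF hol[OF that]] gh[OF that] by simp
    then show ?thesis
      unfolding N_def by (intro holomorphic_on_UN_open) auto
  qed
  moreover have "g (of_real x) = of_real (f x)" if "complex_of_real x \<in> N" for x
    using k[OF that] hf by (simp add: g_def)
  moreover have "complex_of_real ` I \<subseteq> N" using r by (auto simp: N_def)
  moreover have "open N" by (auto simp: N_def)
  ultimately show ?thesis using that by blast
qed

text \<open>The real point whose coordinates exceed those of \<open>p\<close> by
  \<open>r / 4\<close> has distance at most \<open>3 * r / 4\<close> from \<open>p\<close>, so it
  lies in \<open>ball p r\<close>. Unconditional summability there is absolute and yields a majorant
  for the M-test on the whole complex polydisc; this is where \<open>r / 4\<close> comes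
  from.\<close>

lemma real_analytic_on3_polydisc_extension:
  fixes g :: "real^3 \<Rightarrow> real" and c :: "nat \<Rightarrow> nat \<Rightarrow> nat \<Rightarrow> real"
  assumes r: "r > 0"
    and g: "\<And>x. x \<in> ball p r \<Longrightarrow>
      ((\<lambda>(i, j, k). c i j k * (x$1 - p$1)^i * (x$2 - p$2)^j * (x$3 - p$3)^k) has_sum g x) UNIV"
  defines "D \<equiv> {x :: complex^3. \<forall>i. norm (x $ i - of_real (p $ i)) < r / 4}"
  obtains G :: "complex^3 \<Rightarrow> complex" where "continuous_on D G" "\<And>x. cvec x \<in> D \<Longrightarrow> G (cvec x) = of_real (g x)"
    "\<And>S u. open S \<Longrightarrow> (\<And>i. (\<lambda>z. u z $ i) holomorphic_on S) \<Longrightarrow> (\<And>z. z \<in> S \<Longrightarrow> u z \<in> D) \<Longrightarrow>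
       (\<lambda>z. G (u z)) holomorphic_on S"
proof -
  define T where "T = (\<lambda>(i, j, k) (x :: complex^3). of_real (c i j k) * (x$1 - of_real (p$1))^i *
      (x$2 - of_real (p$2))^j * (x$3 - of_real (p$3))^k)"
  define G where "G x = (\<Sum>\<^sub>\<infinity>n. T n x)" for x
  define M where "M = (\<lambda>(i, j, k). \<bar>c i j k * (r/4)^i * (r/4)^j * (r/4)^k\<bar>)"
  have "M summable_on UNIV"
  proof -
    let ?x = "p + (\<chi> i. r / 4)"
    have "norm (\<chi> i::3. r / 4) \<le> (\<Sum>i\<in>UNIV. \<bar>(\<chi> i::3. r / 4) $ i\<bar>)" by (rule norm_le_l1_cart)
    also have "\<dots> < r" using r by simp
    finally have "?x \<in> ball p r" by (simp add: dist_norm)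
    from g[OF this] have "(\<lambda>(i, j, k). c i j k * (r/4)^i * (r/4)^j * (r/4)^k) summable_on UNIV"
      by (auto simp: summable_on_def)
    then show ?thesis
      by (subst (asm) summable_on_iff_abs_summable_on_real) (simp add: M_def case_prod_unfold)
  qed
  moreover have "norm (T n x) \<le> M n" if "x \<in> D" for n x
  proof -
    have 1: "norm (x $ i - of_real (p $ i)) ^ m \<le> (r / 4) ^ m" for i m
      using that by (intro power_mono) (auto simp: D_def less_imp_le)
    obtain i j k where n: "n = (i, j, k)" by (cases n) auto
    show ?thesis
      using r 1 by (auto simp: n T_def M_def norm_mult norm_power abs_mult power_abs intro!: mult_mono)
  qed
  ultimately have ulim: "uniform_limit D (\<lambda>X x. \<Sum>n\<in>X. T n x) G (finite_subsets_at_top UNIV)"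
    unfolding G_def by (intro Weierstrass_m_test_general) auto
  have "continuous_on D G"
  proof (rule uniform_limit_theorem[OF _ ulim])
    show "\<forall>\<^sub>F X in finite_subsets_at_top UNIV. continuous_on D (\<lambda>x. \<Sum>n\<in>X. T n x)"
      by (intro always_eventually allI continuous_on_sum)
         (auto simp: T_def case_prod_unfold intro!: continuous_intros)
  qed simp
  moreover have "(\<lambda>z. G (u z)) holomorphic_on S"
    if S: "open S" and u: "\<And>i. (\<lambda>z. u z $ i) holomorphic_on S" "\<And>z. z \<in> S \<Longrightarrow> u z \<in> D" for S u
  proof (rule holomorphic_on_uniform_limit_open[OF S])
    show "uniform_limit S (\<lambda>X z. \<Sum>n\<in>X. T n (u z)) (\<lambda>z. G (u z)) (finite_subsets_at_top UNIV)"
      using uniform_limit_compose'[OF ulim, of u S] u(2) by auto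
    show "(\<lambda>z. \<Sum>n\<in>X. T n (u z)) holomorphic_on S" for X
      by (auto simp: T_def case_prod_unfold intro!: holomorphic_intros u)
  qed simp
  moreover have "G (cvec x) = of_real (g x)" if "cvec x \<in> D" for x
  proof -
    have x: "\<bar>x $ i - p $ i\<bar> < r / 4" for i
      using that by (simp add: D_def cvec_def flip: of_real_diff)
    have "norm (x - p) \<le> (\<Sum>i\<in>UNIV. \<bar>(x - p) $ i\<bar>)" by (rule norm_le_l1_cart)
    also have "\<dots> < r" using x[of 1] x[of 2] x[of 3] r unfolding sum_3 vector_minus_component by linarith
    finally have "x \<in> ball p r" by (simp add: dist_norm norm_minus_commute)
    from has_sum_of_real[OF g[OF this], where 'a = complex]
    have "((\<lambda>n. T n (cvec x)) has_sum of_real (g x)) UNIV"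
      by (simp add: T_def cvec_def case_prod_unfold)
    then show ?thesis by (simp add: G_def infsumI)
  qed
  ultimately show ?thesis using that by blast
qed

text \<open>Holomorphy of the glued function is expressed through compositions with holomorphic
  curves. It passes from the polydiscs to their union because their preimages under a curve form an
  open cover of its domain.\<close>

lemma real_analytic_on3_holomorphic_extension:
  assumes "real_analytic_on3 U g"
  obtains V and G :: "complex^3 \<Rightarrow> complex" where "open V" "\<And>x. x \<in> U \<Longrightarrow> cvec x \<in> V" "continuous_on V G"
    "\<And>x. cvec x \<in> V \<Longrightarrow> G (cvec x) = of_real (g x)"
    "\<forall>S u. open S \<longrightarrow> (\<forall>i. (\<lambda>z. u z $ i) holomorphic_on S) \<longrightarrow> (\<forall>z\<in>S. u z \<in> V) \<longrightarrow>
       (\<lambda>z. G (u z)) holomorphic_on S"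
proof -
  define D where "D p r = {x :: complex^3. \<forall>i. norm (x $ i - of_real (p $ i)) < r / 4}" for p :: "real^3" and r :: real
  have "\<exists>r (G :: complex^3 \<Rightarrow> complex). r > 0 \<and> continuous_on (D p r) G \<and> (\<forall>x. cvec x \<in> D p r \<longrightarrow> G (cvec x) = of_real (g x)) \<and>
     (\<forall>S u. open S \<longrightarrow> (\<forall>i. (\<lambda>z. u z $ i) holomorphic_on S) \<longrightarrow> (\<forall>z\<in>S. u z \<in> D p r) \<longrightarrow>
       (\<lambda>z. G (u z)) holomorphic_on S)" (is "\<exists>r G. ?P p r G") if p: "p \<in> U" for p
  proof -
    obtain r c where r: "r > 0" "\<And>x. x \<in> ball p r \<Longrightarrow>
       ((\<lambda>(i, j, k). c i j k * (x$1 - p$1)^i * (x$2 - p$2)^j * (x$3 - p$3)^k) has_sum g x) UNIV"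
      using assms p unfolding real_analytic_on3_def by meson
    show ?thesis
      using real_analytic_on3_polydisc_extension[OF r, folded D_def] r(1) by metis
  qed
  then have "\<forall>p\<in>U. \<exists>r G. ?P p r G" by blast
  from bchoice[OF this] obtain r where "\<forall>p\<in>U. \<exists>G. ?P p (r p) G" ..
  from bchoice[OF this] obtain G :: "real^3 \<Rightarrow> complex^3 \<Rightarrow> complex" where "\<forall>p\<in>U. ?P p (r p) (G p)" ..
  then have r: "\<And>p. p \<in> U \<Longrightarrow> r p > 0"
    and cont: "\<And>p. p \<in> U \<Longrightarrow> continuous_on (D p (r p)) (G p)"
    and real: "\<And>p x. p \<in> U \<Longrightarrow> cvec x \<in> D p (r p) \<Longrightarrow> G p (cvec x) = of_real (g x)"
    and hol: "\<And>p S u. p \<in> U \<Longrightarrow> open S \<Longrightarrow> \<forall>i. (\<lambda>z. u z $ i) holomorphic_on S \<Longrightarrow> \<forall>z\<in>S. u z \<in> D p (r p) \<Longrightarrow>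
       (\<lambda>z. G p (u z)) holomorphic_on S"
    by blast+
  define V where "V = (\<Union>p\<in>U. D p (r p))"
  define k where "k x = (SOME p. p \<in> U \<and> x \<in> D p (r p))" for x
  define GG where "GG x = G (k x) x" for x
  have k: "k x \<in> U" "x \<in> D (k x) (r (k x))" if "x \<in> V" for x
    using someI_ex[of "\<lambda>p. p \<in> U \<and> x \<in> D p (r p)"] that by (auto simp: V_def k_def)
  have oD: "open (D p e)" for p e
  proof -
    have "D p e = (\<Inter>i\<in>UNIV. {x. norm (x $ i - of_real (p $ i)) < e / 4})" by (auto simp: D_def)
    moreover have "open {x :: complex^3. norm (x $ i - of_real (p $ i)) < e / 4}" for i
      by (intro open_Collect_less continuous_intros)
    ultimately show ?thesis by (metis (no_types, lifting) finite open_INT)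
  qed
  text \<open>Two local extensions agree at \<^term>\<open>x\<close>, since they agree along the complex line through
    \<^term>\<open>x\<close> and its real part, which meets the real points in an interval.\<close>
  have GGp: "GG x = G p x" if p: "p \<in> U" and x: "x \<in> D p (r p)" for p x
  proof -
    have q: "k x \<in> U" "x \<in> D (k x) (r (k x))" using k x p by (auto simp: V_def)
    define u :: "complex \<Rightarrow> complex^3" where "u = (\<lambda>z. \<chi> i. of_real (Re (x $ i)) + z * of_real (Im (x $ i)))"
    define S where "S p = {z. u z \<in> D p (r p)}" for p
    \<comment> \<open>As an intersection of preimages of discs under linear maps, \<open>S p\<close>
      is open and convex, so two such sets meet in a connected set.\<close>
    have Sball: "S p = (\<Inter>i\<in>UNIV. (\<lambda>z. z * of_real (Im (x $ i))) -` ball (of_real (p $ i - Re (x $ i))) (r p / 4))" for p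
      by (auto simp: S_def D_def u_def dist_norm norm_minus_commute algebra_simps)
    have S: "open (S p)" "convex (S p)" for p
    proof -
      show "open (S p)" unfolding Sball
        by (intro open_INT finite_class.finite_UNIV ballI open_vimage open_ball continuous_intros)
      show "convex (S p)" unfolding Sball
        by (intro convex_INT convex_linear_vimage convex_ball bounded_linear.linear
              bounded_linear_mult_left)
    qed
    have holS: "(\<lambda>z. G p (u z)) holomorphic_on S p" if "p \<in> U" for p
      by (rule hol[OF that S(1)]) (auto simp: u_def S_def intro!: holomorphic_intros)
    have iS: "\<i> \<in> S p" "0 \<in> S p" if "x \<in> D p (r p)" for p
    proof -
      have ui: "u \<i> = x" by (simp add: u_def vec_eq_iff complex_eq_iff)
      then show "\<i> \<in> S p" using that by (simp add: S_def)
      have "norm (of_real (Re (x $ i)) - complex_of_real (p $ i)) < r p / 4" for i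
      proof -
        have "\<bar>Re (x $ i) - p $ i\<bar> \<le> norm (x $ i - of_real (p $ i))"
          using abs_Re_le_cmod[of "x $ i - of_real (p $ i)"] by simp
        also have "\<dots> < r p / 4" using that by (simp add: D_def)
        finally show ?thesis by (simp flip: of_real_diff)
      qed
      then show "0 \<in> S p" by (simp add: S_def D_def u_def)
    qed
    have ureal: "u (of_real t) = cvec (\<chi> i. Re (x $ i) + t * Im (x $ i))" for t
      by (simp add: u_def cvec_def vec_eq_iff)
    have "(\<lambda>z. G p (u z)) \<i> = (\<lambda>z. G (k x) (u z)) \<i>"
    proof (rule holomorphic_eq_if_eq_on_reals[of "S p \<inter> S (k x)" "\<lambda>z. G p (u z)" "\<lambda>z. G (k x) (u z)" 0 \<i> 1])
      show "connected (S p \<inter> S (k x))" by (intro convex_connected convex_Int S)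
      show "G p (u (of_real t)) = G (k x) (u (of_real t))" if "of_real t \<in> S p \<inter> S (k x)" for t
        using that p q by (simp add: S_def ureal real)
    qed (use S iS[OF x] iS[OF q(2)] holomorphic_on_subset[OF holS[OF p]] holomorphic_on_subset[OF holS[OF q(1)]] in auto)
    moreover have "u \<i> = x" by (simp add: u_def vec_eq_iff complex_eq_iff)
    ultimately show ?thesis by (simp add: GG_def)
  qed
  show ?thesis
  proof (rule that[of V GG])
    show "open V" by (auto simp: V_def oD)
    show "cvec x \<in> V" if "x \<in> U" for x
      using that r[OF that] by (auto simp: V_def D_def cvec_def intro!: bexI[of _ x])
    have "continuous_on (D p (r p)) GG" if "p \<in> U" for p
      using cont[OF that] GGp[OF that] by (simp cong: continuous_on_cong)
    then show "continuous_on V GG"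
      unfolding V_def by (intro continuous_on_open_UN oD)
    show "GG (cvec x) = of_real (g x)" if "cvec x \<in> V" for x
      using k[OF that] real by (simp add: GG_def)
    show "\<forall>S u. open S \<longrightarrow> (\<forall>i. (\<lambda>z. u z $ i) holomorphic_on S) \<longrightarrow> (\<forall>z\<in>S. u z \<in> V) \<longrightarrow>
       (\<lambda>z. GG (u z)) holomorphic_on S"
    proof (intro allI impI)
      fix S and u :: "complex \<Rightarrow> complex^3"
      assume S: "open S" and "\<forall>i. (\<lambda>z. u z $ i) holomorphic_on S" "\<forall>z\<in>S. u z \<in> V"
      then have u: "\<And>i. (\<lambda>z. u z $ i) holomorphic_on S" "\<And>z. z \<in> S \<Longrightarrow> u z \<in> V" by auto
      have cu: "continuous_on S u"
        using u(1)[THEN holomorphic_on_imp_continuous_on] by (rule continuous_on_componentwise_vec)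
      have "(\<lambda>z. GG (u z)) holomorphic_on (\<Union>p\<in>U. S \<inter> u -` D p (r p))"
      proof (rule holomorphic_on_UN_open)
        fix p assume p: "p \<in> U"
        show o: "open (S \<inter> u -` D p (r p))" using cu S oD by (rule continuous_open_preimage)
        have "(\<lambda>z. G p (u z)) holomorphic_on (S \<inter> u -` D p (r p))"
          by (rule hol[OF p o]) (use holomorphic_on_subset[OF u(1)] in auto)
        then show "(\<lambda>z. GG (u z)) holomorphic_on (S \<inter> u -` D p (r p))"
          by (rule holomorphic_transform) (use GGp[OF p] in auto)
      qed
      moreover have "(\<Union>p\<in>U. S \<inter> u -` D p (r p)) = S" using u(2) by (auto simp: V_def)
      ultimately show "(\<lambda>z. GG (u z)) holomorphic_on S" by simp
    qed
  qed
qed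

section \<open>Functions holomorphic along complex lines\<close>

text \<open>Unlike joint differentiability, this notion passes to uniform limits at once.\<close>

definition line_holomorphic_on :: "(complex \<times> complex \<Rightarrow> complex) \<Rightarrow> (complex \<times> complex) set \<Rightarrow> bool"
    (infixl "line'_holomorphic'_on" 50) where
  "f line_holomorphic_on W \<longleftrightarrow> continuous_on W f \<and>
     (\<forall>a b u v. (\<lambda>x. f (a + x * u, b + x * v)) holomorphic_on {x. (a + x * u, b + x * v) \<in> W})"

lemma line_holomorphic_on_imp_continuous_on: "f line_holomorphic_on W \<Longrightarrow> continuous_on W f"
  by (simp add: line_holomorphic_on_def)

lemma line_holomorphic_onD:
  "f line_holomorphic_on W \<Longrightarrow> (\<lambda>x. f (a + x * u, b + x * v)) holomorphic_on {x. (a + x * u, b + x * v) \<in> W}"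
  unfolding line_holomorphic_on_def by blast

lemma open_line_preimage:
  assumes "open W"
  shows "open {x. (a + x * u, b + x * v :: complex) \<in> W}"
  using open_vimage[OF assms, of "\<lambda>x. (a + x * u, b + x * v)"]
  by (simp add: vimage_def continuous_intros)

lemma line_holomorphic_on_add:
  assumes "f line_holomorphic_on W" "g line_holomorphic_on W"
  shows "(\<lambda>q. f q + g q) line_holomorphic_on W"
  unfolding line_holomorphic_on_def
  by (intro conjI allI continuous_intros holomorphic_intros assms line_holomorphic_onD
        line_holomorphic_on_imp_continuous_on)

lemma line_holomorphic_on_fst:
  assumes "g holomorphic_on D"
  shows "(\<lambda>q. g (fst q)) line_holomorphic_on (D \<times> E)"
  unfolding line_holomorphic_on_def
proof (intro conjI allI)
  show "continuous_on (D \<times> E) (\<lambda>q. g (fst q))"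
    by (rule continuous_on_compose2[OF holomorphic_on_imp_continuous_on[OF assms]])
       (auto intro!: continuous_intros)
  show "(\<lambda>x. g (fst (a + x * u, b + x * v))) holomorphic_on {x. (a + x * u, b + x * v) \<in> D \<times> E}" for a b u v
    unfolding fst_conv
    by (rule holomorphic_on_compose_gen[OF _ assms, unfolded o_def])
       (auto intro!: holomorphic_intros)
qed

lemma line_holomorphic_on_uniform_limit:
  assumes "open W" and f: "\<And>n. f n line_holomorphic_on W" and lim: "uniform_limit W f g F" and F: "F \<noteq> bot"
  shows "g line_holomorphic_on W"
  unfolding line_holomorphic_on_def
proof (intro conjI allI)
  show "continuous_on W g"
  proof (rule uniform_limit_theorem[OF _ lim F])
    show "\<forall>\<^sub>F n in F. continuous_on W (f n)"
      by (intro always_eventually allI line_holomorphic_on_imp_continuous_on f)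
  qed
  fix a b u v
  show "(\<lambda>x. g (a + x * u, b + x * v)) holomorphic_on {x. (a + x * u, b + x * v) \<in> W}"
  proof (rule holomorphic_on_uniform_limit_open[OF open_line_preimage[OF \<open>open W\<close>] _ _ F])
    show "(\<lambda>x. f n (a + x * u, b + x * v)) holomorphic_on {x. (a + x * u, b + x * v) \<in> W}" for n
      using f by (rule line_holomorphic_onD)
    show "uniform_limit {x. (a + x * u, b + x * v) \<in> W} (\<lambda>n x. f n (a + x * u, b + x * v))
        (\<lambda>x. g (a + x * u, b + x * v)) F"
      using uniform_limit_compose'[OF lim, of "\<lambda>x. (a + x * u, b + x * v)"] by auto
  qed
qed

text \<open>Conjugating both the argument and the value preserves holomorphy. Swapping the two
  arguments as well makes the result equal to the plain conjugate of \<open>f\<close> where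
  \<open>w = cnj z\<close>.\<close>

lemma line_holomorphic_on_reflect:
  assumes W': "open W" and f: "f line_holomorphic_on W"
    and W: "\<And>z w. (z, w) \<in> W \<Longrightarrow> (cnj w, cnj z) \<in> W"
  shows "(\<lambda>q. cnj (f (cnj (snd q), cnj (fst q)))) line_holomorphic_on W"
  unfolding line_holomorphic_on_def
proof (intro conjI allI)
  show "continuous_on W (\<lambda>q. cnj (f (cnj (snd q), cnj (fst q))))"
  proof (rule continuous_on_cnj[OF continuous_on_compose2[of W f]])
    show "continuous_on W f" using f by (rule line_holomorphic_on_imp_continuous_on)
    show "continuous_on W (\<lambda>q. (cnj (snd q), cnj (fst q)))" by (intro continuous_intros)
    show "(\<lambda>q. (cnj (snd q), cnj (fst q))) ` W \<subseteq> W"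
    proof
      fix q assume "q \<in> (\<lambda>q. (cnj (snd q), cnj (fst q))) ` W"
      then obtain z w where "(z, w) \<in> W" "q = (cnj w, cnj z)" by auto
      then show "q \<in> W" using W by simp
    qed
  qed
  fix a b u v
  let ?g = "\<lambda>x. f (cnj b + x * cnj v, cnj a + x * cnj u)"
  let ?S = "{x. (a + x * u, b + x * v) \<in> W}"
  have "?g holomorphic_on {x. (cnj b + x * cnj v, cnj a + x * cnj u) \<in> W}"
    using f by (rule line_holomorphic_onD)
  moreover have "cnj ` ?S \<subseteq> {x. (cnj b + x * cnj v, cnj a + x * cnj u) \<in> W}"
    using W[of "a + x * u" "b + x * v" for x] by (simp add: image_subset_iff)
  ultimately have "?g holomorphic_on (cnj ` ?S)"
    by (rule holomorphic_on_subset)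
  then have "(cnj \<circ> ?g \<circ> cnj) holomorphic_on ?S"
    by (intro holomorphic_on_compose_cnj_cnj open_line_preimage W')
  then show "(\<lambda>x. cnj (f (cnj (snd (a + x * u, b + x * v)), cnj (fst (a + x * u, b + x * v))))) holomorphic_on ?S"
    by (simp add: o_def)
qed

text \<open>Along a complex line in the \<open>(z, w)\<close>-space the pair \<open>(P, Q)\<close>
  is a curve with holomorphic components, which is just what \<open>holomorphic_along_curves\<close>
  accepts.\<close>

lemma line_holomorphic_on_compose:
  assumes W: "open W" and Phi: "continuous_on V \<Phi>" "holomorphic_along_curves V \<Phi>"
    and P: "\<And>i. (\<lambda>q. P q $ i) line_holomorphic_on W" and Q: "\<And>i. (\<lambda>q. Q q $ i) line_holomorphic_on W"
    and V: "\<And>q. q \<in> W \<Longrightarrow> (P q, Q q) \<in> V"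
  shows "(\<lambda>q. \<Phi> (P q, Q q)) line_holomorphic_on W"
  unfolding line_holomorphic_on_def
proof (intro conjI allI)
  have "continuous_on W P" "continuous_on W Q"
    by (intro continuous_on_componentwise_vec line_holomorphic_on_imp_continuous_on P Q)+
  then show "continuous_on W (\<lambda>q. \<Phi> (P q, Q q))"
    by (rule continuous_on_compose2[OF Phi(1) continuous_on_Pair]) (use V in auto)
  fix a b u v
  show "(\<lambda>x. \<Phi> (P (a + x * u, b + x * v), Q (a + x * u, b + x * v))) holomorphic_on {x. (a + x * u, b + x * v) \<in> W}"
    by (rule Phi(2)[unfolded holomorphic_along_curves_def, rule_format, OF open_line_preimage[OF W]])
       (use line_holomorphic_onD[OF P] line_holomorphic_onD[OF Q] V in auto)
qed

text \<open>Parametrised over [0,1], the integrand is holomorphic along every line for each fixed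
  \<open>t\<close>, and integration over \<open>t\<close> preserves this. Convexity of
  \<open>D\<close> keeps the moving segment inside \<open>D\<close>.\<close>

lemma line_holomorphic_on_contour_integral:
  assumes D: "open D" "convex D" and h: "h line_holomorphic_on (D \<times> D)"
  shows "(\<lambda>q. contour_integral (linepath (fst q) (snd q)) (\<lambda>x. h (fst q, x))) line_holomorphic_on (D \<times> D)"
proof -
  let ?l = "\<lambda>(q :: complex \<times> complex) t. h (fst q, linepath (fst q) (snd q) t) * (snd q - fst q)"
  have inD: "linepath z w t \<in> D" if "z \<in> D" "w \<in> D" "t \<in> {0..1}" for z w t
    using closed_segment_subset[OF that(1,2) D(2)] linepath_in_path[OF that(3), of z w] by blast
  have eq: "contour_integral (linepath (fst q) (snd q)) (\<lambda>x. h (fst q, x)) = integral {0..1} (?l q)" for q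
    by (simp add: contour_integral_integral)
  have contl: "continuous_on ((D \<times> D) \<times> {0..1}) (\<lambda>(q, t). ?l q t)"
  proof -
    have "continuous_on ((D \<times> D) \<times> {0..1}) (\<lambda>x. h (fst (fst x), linepath (fst (fst x)) (snd (fst x)) (snd x)))"
    proof (rule continuous_on_compose2[of "D \<times> D" h])
      show "continuous_on (D \<times> D) h" using h by (rule line_holomorphic_on_imp_continuous_on)
      show "continuous_on ((D \<times> D) \<times> {0..1}) (\<lambda>x. (fst (fst x), linepath (fst (fst x)) (snd (fst x)) (snd x)))"
        unfolding linepath_def by (intro continuous_intros)
    qed (use inD in auto)
    then show ?thesis unfolding case_prod_unfold by (intro continuous_intros)
  qed
  show ?thesis
    unfolding eq line_holomorphic_on_def
  proof (intro conjI allI)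
    show "continuous_on (D \<times> D) (\<lambda>q. integral {0..1} (?l q))"
      using integral_continuous_on_param[of "D \<times> D" 0 1 ?l] contl by simp
    fix a b u v
    let ?S = "{x. (a + x * u, b + x * v) \<in> D \<times> D}"
    show "(\<lambda>x. integral {0..1} (?l (a + x * u, b + x * v))) holomorphic_on ?S"
    proof (rule holomorphic_on_integral_parametric)
      show "open ?S" using D by (intro open_line_preimage open_Times)
      show "convex ?S"
      proof (rule convexI)
        fix x y :: complex and s t :: real assume xy: "x \<in> ?S" "y \<in> ?S" "0 \<le> s" "0 \<le> t" "s + t = 1"
        have "c + (s *\<^sub>R x + t *\<^sub>R y) * d = s *\<^sub>R (c + x * d) + t *\<^sub>R (c + y * d)" for c d
        proof -
          have "s *\<^sub>R (c + x * d) + t *\<^sub>R (c + y * d) = (s + t) *\<^sub>R c + (s *\<^sub>R x + t *\<^sub>R y) * d"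
            by (simp add: algebra_simps)
          then show ?thesis using xy by simp
        qed
        moreover have "s *\<^sub>R (a + x * u) + t *\<^sub>R (a + y * u) \<in> D" "s *\<^sub>R (b + x * v) + t *\<^sub>R (b + y * v) \<in> D"
          using xy by (intro convexD[OF D(2)]; simp)+
        ultimately show "s *\<^sub>R x + t *\<^sub>R y \<in> ?S" by simp
      qed
      show "continuous_on (?S \<times> {0..1}) (\<lambda>(x, t). ?l (a + x * u, b + x * v) t)"
      proof -
        have "continuous_on (?S \<times> {0..1}) (\<lambda>y. (\<lambda>(q, t). ?l q t) ((a + fst y * u, b + fst y * v), snd y))"
          by (rule continuous_on_compose2[OF contl]) (auto intro!: continuous_intros)
        then show ?thesis by (simp add: case_prod_unfold)
      qed
      fix t :: real assume t: "t \<in> {0..1}"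
      \<comment> \<open>When both end points move along complex lines with a common parameter, so
        does the point of the segment with fixed \<open>t\<close>; \<open>?b\<close> and
        \<open>?v\<close> are its base point and direction.\<close>
      let ?b = "(1 - t) *\<^sub>R a + t *\<^sub>R b" and ?v = "(1 - t) *\<^sub>R u + t *\<^sub>R v"
      have lp: "linepath (a + x * u) (b + x * v) t = ?b + x * ?v" for x
        by (simp add: linepath_def algebra_simps)
      have "(\<lambda>x. h (a + x * u, ?b + x * ?v)) holomorphic_on {x. (a + x * u, ?b + x * ?v) \<in> D \<times> D}"
        using h by (rule line_holomorphic_onD)
      then have "(\<lambda>x. h (a + x * u, ?b + x * ?v)) holomorphic_on ?S"
        by (rule holomorphic_on_subset) (use inD[OF _ _ t, unfolded lp] lp in \<open>auto simp flip: lp intro!: inD[OF _ _ t]\<close>)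
      then show "(\<lambda>x. ?l (a + x * u, b + x * v) t) holomorphic_on ?S"
        by (auto simp: lp intro!: holomorphic_intros)
    qed
  qed
qed

lemma line_holomorphic_on_imp_holomorphic:
  assumes "f line_holomorphic_on W" "\<And>z. z \<in> S \<Longrightarrow> (z, w) \<in> W"
  shows "(\<lambda>z. f (z, w)) holomorphic_on S"
proof -
  have "(\<lambda>z. f (z, w)) holomorphic_on {z. (z, w) \<in> W}"
    using line_holomorphic_onD[OF assms(1), of 0 1 w 0] by simp
  then show ?thesis by (rule holomorphic_on_subset) (use assms(2) in auto)
qed

lemma line_holomorphic_on_imp_holomorphic_snd:
  assumes "f line_holomorphic_on W" "\<And>w. w \<in> S \<Longrightarrow> (z, w) \<in> W"
  shows "(\<lambda>w. f (z, w)) holomorphic_on S"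
proof -
  have "(\<lambda>w. f (z, w)) holomorphic_on {w. (z, w) \<in> W}"
    using line_holomorphic_onD[OF assms(1), of z 0 0 1] by simp
  then show ?thesis by (rule holomorphic_on_subset) (use assms(2) in auto)
qed

lemma continuous_on_partial_deriv:
  assumes "f line_holomorphic_on (D \<times> D)" "open D"
  shows "continuous_on (D \<times> D) (\<lambda>(z, w). deriv (\<lambda>z. f (z, w)) z)"
  using assms line_holomorphic_on_imp_holomorphic[OF assms(1)]
  by (intro continuous_on_deriv_parametric[of D D "\<lambda>z w. f (z, w)"])
     (auto dest: line_holomorphic_on_imp_continuous_on)

text \<open>Total differentiability follows from the \<open>z\<close>-derivative at the point
  together with a continuous \<open>w\<close>-derivative nearby. The chain rule with
  \<open>z \<mapsto> (z, cnj z)\<close> then turns the \<open>w\<close>-derivative into the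
  coefficient of \<open>cnj h\<close>, which is the zbar-derivative.\<close>

lemma has_derivative_on_antidiagonal:
  assumes D: "open D" "convex D" and f: "f line_holomorphic_on (D \<times> D)"
    and fw: "\<And>z w. z \<in> D \<Longrightarrow> w \<in> D \<Longrightarrow> ((\<lambda>w. f (z, w)) has_field_derivative g (z, w)) (at w)"
    and g: "continuous_on (D \<times> D) g" and z: "z \<in> D" "cnj z \<in> D"
  shows "((\<lambda>z. f (z, cnj z)) has_derivative
      (\<lambda>h. deriv (\<lambda>x. f (x, cnj z)) z * h + g (z, cnj z) * cnj h)) (at z)"
proof -
  have "((\<lambda>(x, y). (\<lambda>x y. f (x, y)) x y) has_derivative
      (\<lambda>(tx, ty). (*) (deriv (\<lambda>x. f (x, cnj z)) z) tx +
         blinfun_apply ((\<lambda>x y. blinfun_mult_right (g (x, y))) z (cnj z)) ty)) (at (z, cnj z) within D \<times> D)"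
  proof (rule has_derivative_partialsI)
    show "((\<lambda>x. f (x, cnj z)) has_derivative (*) (deriv (\<lambda>x. f (x, cnj z)) z)) (at z within D)"
      using holomorphic_derivI[OF line_holomorphic_on_imp_holomorphic[OF f, of D "cnj z"] D(1) z(1)] z
      by (simp add: has_field_derivative_def)
    show "((\<lambda>y. f (x, y)) has_derivative blinfun_apply (blinfun_mult_right (g (x, y)))) (at y within D)"
      if "x \<in> D" "y \<in> D" for x y
      using fw[OF that] by (simp add: has_field_derivative_def has_derivative_at_withinI)
    have "continuous_on (D \<times> D) (\<lambda>q. blinfun_mult_right (g q))"
      by (intro bounded_linear.continuous_on[OF bounded_linear_blinfun_mult_right] g)
    then show "continuous (at (z, cnj z) within D \<times> D) (\<lambda>(x, y). blinfun_mult_right (g (x, y)))"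
      using z by (simp add: continuous_on_eq_continuous_within case_prod_unfold)
  qed (use z D in auto)
  then have "(f has_derivative (\<lambda>(tx, ty). deriv (\<lambda>x. f (x, cnj z)) z * tx + g (z, cnj z) * ty)) (at (z, cnj z))"
    using z D by (simp add: at_within_open[OF _ open_Times])
  moreover have "((\<lambda>z. (z, cnj z)) has_derivative (\<lambda>h. (h, cnj h))) (at z)"
    by (intro has_derivative_Pair has_derivative_ident bounded_linear.has_derivative[OF bounded_linear_cnj])
  ultimately have "((\<lambda>z. f (z, cnj z)) has_derivative
      (\<lambda>h. case (h, cnj h) of (tx, ty) \<Rightarrow> deriv (\<lambda>x. f (x, cnj z)) z * tx + g (z, cnj z) * ty)) (at z)"
    using has_derivative_compose[of "\<lambda>z. (z, cnj z)" "\<lambda>h. (h, cnj h)" z UNIV f] by blast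
  then show ?thesis by simp
qed

lemma has_field_derivative_contour_integral_linepath:
  assumes D: "open D" "convex D" and f: "f holomorphic_on D" and z: "z \<in> D" "w \<in> D"
  shows "((\<lambda>w. contour_integral (linepath z w) f) has_field_derivative f w) (at w)"
proof -
  obtain G where G: "\<And>x. x \<in> D \<Longrightarrow> (G has_field_derivative f x) (at x within D)"
    using holomorphic_convex_primitive'[OF D(2,1) f] by blast
  have "contour_integral (linepath z y) f = G y - G z" if "y \<in> D" for y
  proof -
    have "path_image (linepath z y) \<subseteq> D"
      using closed_segment_subset[OF z(1) that D(2)] by simp
    from contour_integral_primitive[of D G f, OF G valid_path_linepath this]
    have "(f has_contour_integral G y - G z) (linepath z y)" by simp
    then show ?thesis by (rule contour_integral_unique)
  qed
  then have eq: "G y - G z = contour_integral (linepath z y) f" if "y \<in> D" for y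
    using that by simp
  have "(G has_field_derivative f w) (at w)" using G[OF z(2)] by (simp add: at_within_open[OF z(2) D(1)])
  then have "((\<lambda>y. G y - G z) has_field_derivative f w) (at w)"
    by (auto intro!: derivative_eq_intros)
  then show ?thesis
    by (rule has_field_derivative_transform_within_open[OF _ D(1) z(2) eq])
qed

section \<open>The Cauchy problem for a nonlinear dbar-equation\<close>

definition vcnj :: "complex^3 \<Rightarrow> complex^3" where
  "vcnj v = (\<chi> i. cnj (v $ i))"

text \<open>Squares rather than discs: being products of intervals, they suit partial derivatives
  and integration along vertical segments, and they are still convex and invariant under
  conjugation.\<close>

definition sq :: "real \<Rightarrow> real \<Rightarrow> complex set" where
  "sq s \<rho> = {z. \<bar>Re z - s\<bar> < \<rho> \<and> \<bar>Im z\<bar> < \<rho>}"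

lemma open_sq: "open (sq s \<rho>)"
  unfolding sq_def by (intro open_Collect_conj open_Collect_less continuous_intros)

lemma convex_sq: "convex (sq s \<rho>)"
proof -
  have "sq s \<rho> = Re -` {s - \<rho><..<s + \<rho>} \<inter> Im -` {-\<rho><..<\<rho>}"
    by (auto simp: sq_def)
  moreover have "convex \<dots>"
    by (intro convex_Int convex_linear_vimage bounded_linear.linear bounded_linear_Re bounded_linear_Im)
       auto
  ultimately show ?thesis by simp
qed

lemma cnj_in_sq [simp]: "cnj z \<in> sq s \<rho> \<longleftrightarrow> z \<in> sq s \<rho>"
  by (simp add: sq_def)

lemma norm_diff_sq:
  assumes "z \<in> sq s \<rho>" "w \<in> sq s \<rho>"
  shows "norm (w - z) \<le> 4 * \<rho>"
  using assms cmod_le[of "w - z"] by (auto simp: sq_def)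

text \<open>The radius \<open>\<rho>\<close> depends on the centre \<open>s\<close>, but \<open>p0\<close> and \<open>F\<close> do not: the solution is constructed
  on all squares simultaneously, and no gluing of local solutions is needed.\<close>

locale picard =
  fixes V :: "((complex^3) \<times> (complex^3)) set" and F :: "(complex^3) \<times> (complex^3) \<Rightarrow> complex^3"
    and p0 :: "complex \<Rightarrow> complex^3" and I :: "real set" and \<rho> e K :: "real \<Rightarrow> real"
  assumes V: "open V" and contF: "\<And>i. continuous_on V (\<lambda>x. F x $ i)"
    and holF: "\<And>i. holomorphic_along_curves V (\<lambda>x. F x $ i)"
    and pos: "\<And>s. s \<in> I \<Longrightarrow> \<rho> s > 0" "\<And>s. s \<in> I \<Longrightarrow> e s > 0" "\<And>s. s \<in> I \<Longrightarrow> K s > 0"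
    and p0_hol: "\<And>s i. s \<in> I \<Longrightarrow> (\<lambda>z. p0 z $ i) holomorphic_on sq s (\<rho> s)"
    and p0_near: "\<And>s z i. s \<in> I \<Longrightarrow> z \<in> sq s (\<rho> s) \<Longrightarrow> norm (p0 z $ i - p0 s $ i) \<le> e s / 2"
    and inV: "\<And>s u v. s \<in> I \<Longrightarrow> (\<And>i. norm (u $ i - p0 s $ i) \<le> e s) \<Longrightarrow>
       (\<And>i. norm (v $ i - cnj (p0 s $ i)) \<le> e s) \<Longrightarrow> (u, v) \<in> V"
    and bound: "\<And>s u v i. s \<in> I \<Longrightarrow> (\<And>i. norm (u $ i - p0 s $ i) \<le> e s) \<Longrightarrow>
       (\<And>i. norm (v $ i - cnj (p0 s $ i)) \<le> e s) \<Longrightarrow> norm (F (u, v) $ i) \<le> K s"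
    and lip: "\<And>s u v u' v' i \<delta>. s \<in> I \<Longrightarrow> (\<And>i. norm (u $ i - p0 s $ i) \<le> e s) \<Longrightarrow>
       (\<And>i. norm (v $ i - cnj (p0 s $ i)) \<le> e s) \<Longrightarrow> (\<And>i. norm (u' $ i - p0 s $ i) \<le> e s) \<Longrightarrow>
       (\<And>i. norm (v' $ i - cnj (p0 s $ i)) \<le> e s) \<Longrightarrow>
       (\<And>i. norm (u $ i - u' $ i) \<le> \<delta>) \<Longrightarrow> (\<And>i. norm (v $ i - v' $ i) \<le> \<delta>) \<Longrightarrow>
       norm (F (u, v) $ i - F (u', v') $ i) \<le> K s * \<delta>"
    and small: "\<And>s. s \<in> I \<Longrightarrow> 4 * \<rho> s * K s \<le> e s / 2" "\<And>s. s \<in> I \<Longrightarrow> 4 * \<rho> s * K s \<le> 1 / 2"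
begin

section \<open>The Picard operator and its contraction property\<close>

definition "Q s = sq s (\<rho> s) \<times> sq s (\<rho> s)"

definition cj :: "(complex \<times> complex \<Rightarrow> complex^3) \<Rightarrow> complex \<times> complex \<Rightarrow> complex^3" where
  "cj P q = vcnj (P (cnj (snd q), cnj (fst q)))"

text \<open>For \<open>p z = P (z, cnj z)\<close> one has \<open>cj P (z, cnj z) = vcnj (p z)\<close>, and a fixed point of the
  following operator satisfies \<open>P(z, z) = p0 z\<close> and \<open>dP/dw = F (P, cj P)\<close>.  The integrand contains no
  derivative of \<open>P\<close>, so that a plain contraction argument works on the union of the sets \<open>Q s\<close>.\<close>

definition step :: "(complex \<times> complex \<Rightarrow> complex^3) \<Rightarrow> complex \<times> complex \<Rightarrow> complex^3" where
  "step P q = (\<chi> i. p0 (fst q) $ i +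
     contour_integral (linepath (fst q) (snd q)) (\<lambda>x. F (P (fst q, x), cj P (fst q, x)) $ i))"

text \<open>The bound \<open>e s\<close> keeps \<open>(P, cj P)\<close> in the part of
  \<open>V\<close> where \<open>F\<close> is bounded by \<open>K s\<close> and Lipschitz.\<close>

definition admissible :: "(complex \<times> complex \<Rightarrow> complex^3) \<Rightarrow> bool" where
  "admissible P \<longleftrightarrow> (\<forall>s\<in>I. \<forall>i. (\<lambda>q. P q $ i) line_holomorphic_on Q s \<and>
     (\<forall>q\<in>Q s. norm (P q $ i - p0 s $ i) \<le> e s))"

lemma open_Q: "open (Q s)"
  by (simp add: Q_def open_Times open_sq)

lemma refl_Q: "(z, w) \<in> Q s \<Longrightarrow> (cnj w, cnj z) \<in> Q s"
  by (simp add: Q_def)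

lemma admissible_near:
  assumes "admissible P" "s \<in> I" "q \<in> Q s"
  shows "norm (P q $ i - p0 s $ i) \<le> e s" "norm (cj P q $ i - cnj (p0 s $ i)) \<le> e s"
proof -
  show "norm (P q $ i - p0 s $ i) \<le> e s" using assms by (auto simp: admissible_def)
  have "(cnj (snd q), cnj (fst q)) \<in> Q s" using assms(3) refl_Q[of "fst q" "snd q"] by simp
  then have "norm (P (cnj (snd q), cnj (fst q)) $ i - p0 s $ i) \<le> e s"
    using assms by (auto simp: admissible_def)
  then show "norm (cj P q $ i - cnj (p0 s $ i)) \<le> e s"
    by (simp add: cj_def vcnj_def flip: complex_cnj_diff)
qed

lemma admissible_F:
  assumes "admissible P" "s \<in> I"
  shows "(\<lambda>q. F (P q, cj P q) $ i) line_holomorphic_on Q s"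
    and "q \<in> Q s \<Longrightarrow> (P q, cj P q) \<in> V"
    and "q \<in> Q s \<Longrightarrow> norm (F (P q, cj P q) $ i) \<le> K s"
proof -
  have P: "(\<lambda>q. P q $ i) line_holomorphic_on Q s" for i
    using assms by (auto simp: admissible_def)
  have cP: "(\<lambda>q. cj P q $ i) line_holomorphic_on Q s" for i
    using line_holomorphic_on_reflect[OF open_Q P refl_Q] by (simp add: cj_def vcnj_def)
  show in_V: "(P q, cj P q) \<in> V" if "q \<in> Q s" for q
    by (rule inV[OF assms(2)]) (rule admissible_near[OF assms that])+
  show "(\<lambda>q. F (P q, cj P q) $ i) line_holomorphic_on Q s"
    by (rule line_holomorphic_on_compose[OF open_Q contF holF P cP in_V])
  show "norm (F (P q, cj P q) $ i) \<le> K s" if "q \<in> Q s"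
    by (rule bound[OF assms(2)]) (rule admissible_near[OF assms that])+
qed

lemma segment_Q:
  assumes "(z, w) \<in> Q s" "x \<in> closed_segment z w"
  shows "(z, x) \<in> Q s"
  using assms closed_segment_subset[OF _ _ convex_sq, of z s "\<rho> s" w] by (auto simp: Q_def)

lemma F_integrable:
  assumes "admissible P" "s \<in> I" "(z, w) \<in> Q s"
  shows "(\<lambda>x. F (P (z, x), cj P (z, x)) $ i) contour_integrable_on linepath z w"
proof (rule contour_integrable_continuous_linepath)
  show "continuous_on (closed_segment z w) (\<lambda>x. F (P (z, x), cj P (z, x)) $ i)"
    by (rule continuous_on_compose2[OF line_holomorphic_on_imp_continuous_on[OF admissible_F(1)[OF assms(1,2)]]])
       (use segment_Q[OF assms(3)] in \<open>auto intro!: continuous_intros\<close>)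
qed

text \<open>The allowance \<open>e s\<close> is spent in two halves: one on the oscillation of
  \<open>p0\<close> over the square, the other on the integral over a segment of length at most
  \<open>4 * \<rho> s\<close> with integrand bounded by \<open>K s\<close>.\<close>

lemma admissible_step:
  assumes P: "admissible P"
  shows "admissible (step P)"
  unfolding admissible_def
proof (intro ballI allI conjI)
  fix s i assume s: "s \<in> I"
  show "(\<lambda>q. step P q $ i) line_holomorphic_on Q s"
    unfolding step_def Q_def vec_lambda_beta
    by (intro line_holomorphic_on_add line_holomorphic_on_fst p0_hol s)
       (rule line_holomorphic_on_contour_integral[OF open_sq convex_sq admissible_F(1)[OF P s, unfolded Q_def]])
  fix q assume q: "q \<in> Q s"
  obtain z w where zw: "q = (z, w)" "z \<in> sq s (\<rho> s)" "w \<in> sq s (\<rho> s)" using q by (auto simp: Q_def)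
  have "norm (contour_integral (linepath z w) (\<lambda>x. F (P (z, x), cj P (z, x)) $ i)) \<le> K s * norm (w - z)"
  proof (rule contour_integral_bound_linepath)
    show "(\<lambda>x. F (P (z, x), cj P (z, x)) $ i) contour_integrable_on linepath z w"
      using F_integrable[OF P s] q zw by simp
    show "norm (F (P (z, x), cj P (z, x)) $ i) \<le> K s" if "x \<in> closed_segment z w" for x
      using admissible_F(3)[OF P s] segment_Q[of z w s x] q zw that by blast
  qed (use pos s in \<open>simp add: less_imp_le\<close>)
  also have "\<dots> \<le> K s * (4 * \<rho> s)"
    using norm_diff_sq[OF zw(2,3)] pos(3)[OF s] by (intro mult_left_mono) auto
  finally have 1: "norm (contour_integral (linepath z w) (\<lambda>x. F (P (z, x), cj P (z, x)) $ i)) \<le> e s / 2"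
    using small(1)[OF s] by (simp add: mult.commute)
  have "step P q $ i - p0 s $ i = (p0 z $ i - p0 s $ i) +
      contour_integral (linepath z w) (\<lambda>x. F (P (z, x), cj P (z, x)) $ i)"
    by (simp add: step_def zw)
  also have "norm \<dots> \<le> e s / 2 + e s / 2"
    using p0_near[OF s zw(2)] 1 by (intro norm_triangle_mono)
  finally show "norm (step P q $ i - p0 s $ i) \<le> e s" by simp
qed

text \<open>A bound on one \<open>Q s\<close> improves on the same \<open>Q s\<close>, because the
  integration segment and its reflection, at which \<open>cj\<close> evaluates, both stay inside it.
  The factor is length times Lipschitz constant, \<open>4 * \<rho> s * K s\<close>, which is at most
  1/2.\<close>

lemma step_contracts:
  assumes P: "admissible P" and P': "admissible P'" and s: "s \<in> I"
    and \<delta>: "\<And>q i. q \<in> Q s \<Longrightarrow> norm (P q $ i - P' q $ i) \<le> \<delta>" and q: "q \<in> Q s"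
  shows "norm (step P q $ i - step P' q $ i) \<le> \<delta> / 2"
proof -
  obtain z w where zw: "q = (z, w)" "z \<in> sq s (\<rho> s)" "w \<in> sq s (\<rho> s)" using q by (auto simp: Q_def)
  have d0: "\<delta> \<ge> 0" using \<delta>[OF q, of 1] norm_ge_zero order_trans by blast
  let ?f = "\<lambda>P x. F (P (z, x), cj P (z, x)) $ i"
  have int: "?f P contour_integrable_on linepath z w" "?f P' contour_integrable_on linepath z w"
    using F_integrable[OF P s] F_integrable[OF P' s] q zw by simp_all
  have "step P q $ i - step P' q $ i = contour_integral (linepath z w) (\<lambda>x. ?f P x - ?f P' x)"
    by (simp add: step_def zw contour_integral_diff[OF int])
  also have "norm \<dots> \<le> (K s * \<delta>) * norm (w - z)"
  proof (rule contour_integral_bound_linepath)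
    show "(\<lambda>x. ?f P x - ?f P' x) contour_integrable_on linepath z w"
      using int by (rule contour_integrable_diff)
    fix x assume "x \<in> closed_segment z w"
    then have x: "(z, x) \<in> Q s" using segment_Q[of z w s x] q zw by blast
    have cx: "(cnj x, cnj z) \<in> Q s" using refl_Q[OF x] .
    show "norm (?f P x - ?f P' x) \<le> K s * \<delta>"
    proof (rule lip[OF s])
      show "norm (P (z, x) $ i - P' (z, x) $ i) \<le> \<delta>" for i using \<delta>[OF x] .
      show "norm (cj P (z, x) $ i - cj P' (z, x) $ i) \<le> \<delta>" for i
        using \<delta>[OF cx, of i] by (simp add: cj_def vcnj_def flip: complex_cnj_diff)
    qed (use admissible_near[OF P s x] admissible_near[OF P' s x] in auto)
  qed (use pos(3)[OF s] d0 in simp)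
  also have "\<dots> \<le> (K s * \<delta>) * (4 * \<rho> s)"
    using norm_diff_sq[OF zw(2,3)] pos(3)[OF s] d0 by (intro mult_left_mono) auto
  also have "\<dots> = (4 * \<rho> s * K s) * \<delta>" by simp
  also have "\<dots> \<le> 1 / 2 * \<delta>" using small(2)[OF s] d0 by (rule mult_right_mono)
  finally show ?thesis by simp
qed

section \<open>Picard iterates, their limit and the solution on the antidiagonal\<close>

definition iter :: "nat \<Rightarrow> complex \<times> complex \<Rightarrow> complex^3" where
  "iter n = (step ^^ n) (\<lambda>q. p0 (fst q))"

lemma iter_Suc: "iter (Suc n) = step (iter n)"
  by (simp add: iter_def)

lemma admissible_iter: "admissible (iter n)"
proof (induction n)
  case 0
  show ?case
    unfolding admissible_def iter_def
  proof (intro ballI allI conjI)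
    fix s i assume s: "s \<in> I"
    show "(\<lambda>q. (step ^^ 0) (\<lambda>q. p0 (fst q)) q $ i) line_holomorphic_on Q s"
      unfolding Q_def using line_holomorphic_on_fst[OF p0_hol[OF s]] by simp
    show "norm ((step ^^ 0) (\<lambda>q. p0 (fst q)) q $ i - p0 s $ i) \<le> e s" if "q \<in> Q s" for q
      using p0_near[OF s, of "fst q" i] pos(2)[OF s] that by (auto simp: Q_def)
  qed
qed (simp add: iter_Suc admissible_step)

text \<open>Any two iterates differ by at most \<open>2 * e s\<close>, since both stay within
  \<open>e s\<close> of \<open>p0 s\<close>; each application of \<open>step\<close> halves the
  difference.\<close>

lemma iter_diff:
  assumes s: "s \<in> I"
  shows "q \<in> Q s \<Longrightarrow> norm (iter (Suc n) q $ i - iter n q $ i) \<le> 2 * e s * (1/2) ^ n"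
proof (induction n arbitrary: q i)
  case 0
  then show ?case
    using admissible_near(1)[OF admissible_iter s 0, of 0 i] admissible_near(1)[OF admissible_iter s 0, of 1 i]
      norm_triangle_ineq4[of "iter 1 q $ i - p0 s $ i" "iter 0 q $ i - p0 s $ i"] by simp
next
  case (Suc n)
  then show ?case
    using step_contracts[OF admissible_iter admissible_iter s, of "Suc n" n "2 * e s * (1/2) ^ n" q i]
    by (simp add: iter_Suc)
qed

lemma fixed_point:
  obtains P where "admissible P" "\<And>s q. s \<in> I \<Longrightarrow> q \<in> Q s \<Longrightarrow> step P q = P q"
proof -
  \<comment> \<open>A pointwise definition that does not mention \<open>s\<close>: the telescoping
    series converges uniformly on every \<open>Q s\<close>, so the limits on overlapping sets agree
    by construction.\<close>
  define P where "P q = (\<chi> i. p0 (fst q) $ i + (\<Sum>n. iter (Suc n) q $ i - iter n q $ i))" for q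
  have ulim: "uniform_limit (Q s) (\<lambda>n q. iter n q $ i) (\<lambda>q. P q $ i) sequentially" if s: "s \<in> I" for s i
  proof -
    have "summable (\<lambda>n. 2 * e s * (1/2 :: real) ^ n)" by (intro summable_mult summable_geometric) simp
    then have "uniform_limit (Q s) (\<lambda>n q. \<Sum>k<n. iter (Suc k) q $ i - iter k q $ i)
        (\<lambda>q. \<Sum>n. iter (Suc n) q $ i - iter n q $ i) sequentially"
      using iter_diff[OF s] by (intro Weierstrass_m_test)
    from uniform_limit_add[OF uniform_limit_const[where c = "\<lambda>q. p0 (fst q) $ i"] this]
    moreover have "p0 (fst q) $ i + (\<Sum>k<n. iter (Suc k) q $ i - iter k q $ i) = iter n q $ i" for n q
      using sum_lessThan_telescope[of "\<lambda>k. iter k q $ i" n] by (simp add: iter_def)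
    ultimately show ?thesis by (simp add: P_def)
  qed
  have adm: "admissible P"
    unfolding admissible_def
  proof (intro ballI allI conjI)
    fix s i assume s: "s \<in> I"
    show "(\<lambda>q. P q $ i) line_holomorphic_on Q s"
      by (rule line_holomorphic_on_uniform_limit[OF open_Q _ ulim[OF s]])
         (use admissible_iter s in \<open>auto simp: admissible_def\<close>)
    fix q assume q: "q \<in> Q s"
    have "(\<lambda>n. norm (iter n q $ i - p0 s $ i)) \<longlonglongrightarrow> norm (P q $ i - p0 s $ i)"
      by (intro tendsto_intros tendsto_uniform_limitI[OF ulim[OF s] q])
    then show "norm (P q $ i - p0 s $ i) \<le> e s"
      by (rule tendsto_upperbound)
         (use admissible_near(1)[OF admissible_iter s q] in auto)
  qed
  have "step P q $ i = P q $ i" if s: "s \<in> I" and q: "q \<in> Q s" for s q i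
  proof -
    \<comment> \<open>The comparison passes through the next iterate: \<open>step P\<close> is
      within \<open>d / 4\<close> of \<open>step (iter N)\<close>, which is
      \<open>iter (Suc N)\<close> and so within \<open>d / 2\<close> of \<open>P\<close>.\<close>
    have "norm (step P q $ i - P q $ i) \<le> d" if d: "d > 0" for d
    proof -
      have "\<forall>\<^sub>F n in sequentially. \<forall>q\<in>Q s. dist (iter n q $ j) (P q $ j) < d / 2" for j
        by (rule uniform_limitD[OF ulim[OF s]]) (use d in simp)
      from this[of 1] this[of 2] this[of 3]
      have "\<forall>\<^sub>F n in sequentially. \<forall>q\<in>Q s. \<forall>j. norm (iter n q $ j - P q $ j) \<le> d / 2"
        by eventually_elim (auto simp: forall_3 dist_norm less_imp_le)
      then obtain N where N: "\<And>n q j. n \<ge> N \<Longrightarrow> q \<in> Q s \<Longrightarrow> norm (iter n q $ j - P q $ j) \<le> d / 2"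
        unfolding eventually_sequentially by blast
      have "norm (step P q $ i - step (iter N) q $ i) \<le> (d / 2) / 2"
        by (rule step_contracts[OF adm admissible_iter s _ q]) (use N in \<open>simp add: norm_minus_commute\<close>)
      moreover have "norm (step (iter N) q $ i - P q $ i) \<le> d / 2"
        using N[of "Suc N" q i] q by (simp add: iter_Suc)
      ultimately show ?thesis
        using norm_triangle_ineq[of "step P q $ i - step (iter N) q $ i" "step (iter N) q $ i - P q $ i"] d
        by simp
    qed
    then have "norm (step P q $ i - P q $ i) \<le> 0" by (rule field_le_epsilon) simp
    then show ?thesis by simp
  qed
  then show ?thesis using that[OF adm] by (simp add: vec_eq_iff)
qed

text \<open>Where \<open>w = cnj z\<close>, the \<open>z\<close>-derivative of the fixed point
  becomes \<open>a\<close>, and its \<open>w\<close>-derivative, obtained by differentiating the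
  integral at its end point, becomes the coefficient of \<open>cnj h\<close>. At real points the
  segment degenerates and only the initial value \<open>p0\<close> is left. Continuity of
  \<open>a\<close> will give continuous second derivatives of the surface.\<close>

lemma solution:
  obtains p a where
    "\<And>s z. s \<in> I \<Longrightarrow> z \<in> sq s (\<rho> s) \<Longrightarrow> (p z, vcnj (p z)) \<in> V"
    "\<And>s z i. s \<in> I \<Longrightarrow> z \<in> sq s (\<rho> s) \<Longrightarrow> ((\<lambda>z. p z $ i) has_derivative
       (\<lambda>h. a z $ i * h + F (p z, vcnj (p z)) $ i * cnj h)) (at z)"
    "\<And>s i. s \<in> I \<Longrightarrow> continuous_on (sq s (\<rho> s)) (\<lambda>z. a z $ i)"
    "\<And>s. s \<in> I \<Longrightarrow> p (of_real s) = p0 (of_real s)"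
proof -
  obtain P where P: "admissible P" "\<And>s q. s \<in> I \<Longrightarrow> q \<in> Q s \<Longrightarrow> step P q = P q"
    using fixed_point by metis
  define p where "p z = P (z, cnj z)" for z
  define a :: "complex \<Rightarrow> complex^3" where "a z = (\<chi> i. deriv (\<lambda>x. P (x, cnj z) $ i) z)" for z
  have cjp: "cj P (z, cnj z) = vcnj (p z)" for z by (simp add: cj_def p_def)
  show ?thesis
  proof (rule that[of p a])
    fix s assume s: "s \<in> I"
    show "p (of_real s) = p0 (of_real s)"
      using P(2)[OF s, of "(of_real s, of_real s)"] pos(1)[OF s]
      by (simp add: Q_def sq_def p_def step_def vec_eq_iff)
    have lh: "(\<lambda>q. P q $ i) line_holomorphic_on sq s (\<rho> s) \<times> sq s (\<rho> s)" for i
      using P(1) s by (auto simp: admissible_def Q_def)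
    show "continuous_on (sq s (\<rho> s)) (\<lambda>z. a z $ i)" for i
    proof -
      have "continuous_on (sq s (\<rho> s)) (\<lambda>z. (\<lambda>(z, w). deriv (\<lambda>z. P (z, w) $ i) z) (z, cnj z))"
        by (rule continuous_on_compose2[OF continuous_on_partial_deriv[OF lh open_sq]])
           (auto intro!: continuous_intros)
      then show ?thesis by (simp add: a_def)
    qed
    fix z assume z: "z \<in> sq s (\<rho> s)"
    then have zQ: "(z, cnj z) \<in> Q s" by (simp add: Q_def)
    show "(p z, vcnj (p z)) \<in> V"
      using admissible_F(2)[OF P(1) s zQ] by (simp add: cjp) (simp add: p_def)
    fix i
    have "((\<lambda>z. P (z, cnj z) $ i) has_derivative
        (\<lambda>h. deriv (\<lambda>x. P (x, cnj z) $ i) z * h + F (P (z, cnj z), cj P (z, cnj z)) $ i * cnj h)) (at z)"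
    proof (rule has_derivative_on_antidiagonal[OF open_sq convex_sq lh, where g = "\<lambda>q. F (P q, cj P q) $ i"])
      show "continuous_on (sq s (\<rho> s) \<times> sq s (\<rho> s)) (\<lambda>q. F (P q, cj P q) $ i)"
        using line_holomorphic_on_imp_continuous_on[OF admissible_F(1)[OF P(1) s]] by (simp add: Q_def)
      fix x y assume xy: "x \<in> sq s (\<rho> s)" "y \<in> sq s (\<rho> s)"
      have "(\<lambda>y. F (P (x, y), cj P (x, y)) $ i) holomorphic_on sq s (\<rho> s)"
        by (rule line_holomorphic_on_imp_holomorphic_snd[OF admissible_F(1)[OF P(1) s]])
           (use xy in \<open>simp add: Q_def\<close>)
      from has_field_derivative_contour_integral_linepath[OF open_sq convex_sq this xy]
      have "((\<lambda>y. p0 x $ i + contour_integral (linepath x y) (\<lambda>y. F (P (x, y), cj P (x, y)) $ i))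
          has_field_derivative F (P (x, y), cj P (x, y)) $ i) (at y)"
        by (auto intro!: derivative_eq_intros)
      then show "((\<lambda>y. P (x, y) $ i) has_field_derivative F (P (x, y), cj P (x, y)) $ i) (at y)"
      proof (rule has_field_derivative_transform_within_open[OF _ open_sq xy(2)])
        fix y assume "y \<in> sq s (\<rho> s)"
        with xy(1) have "step P (x, y) = P (x, y)" using P(2)[OF s] by (simp add: Q_def)
        then show "p0 x $ i + contour_integral (linepath x y) (\<lambda>y. F (P (x, y), cj P (x, y)) $ i) = P (x, y) $ i"
          by (simp add: step_def vec_eq_iff)
      qed
    qed (use z in simp_all)
    then show "((\<lambda>z. p z $ i) has_derivative (\<lambda>h. a z $ i * h + F (p z, vcnj (p z)) $ i * cnj h)) (at z)"
      unfolding cjp by (simp add: p_def a_def)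
  qed
qed

end

text \<open>The iteration applies once constants are found at each \<open>s\<close>. Local bounds
  and Lipschitz estimates for the three components of \<open>F\<close> determine \<open>e\<close>
  and \<open>K\<close>; only then is \<open>\<rho>\<close> chosen, small against both and against
  the oscillation of \<open>p0\<close>.\<close>

theorem Cauchy_Kovalevskaya_dbar:
  fixes F :: "(complex^3) \<times> (complex^3) \<Rightarrow> complex^3"
  assumes V: "open V" and contF: "\<And>i. continuous_on V (\<lambda>x. F x $ i)"
    and holF: "\<And>i. holomorphic_along_curves V (\<lambda>x. F x $ i)"
    and N: "open N" "complex_of_real ` I \<subseteq> N" and p0: "\<And>i. (\<lambda>z. p0 z $ i) holomorphic_on N"
    and I: "open I" and p0V: "\<And>s. s \<in> I \<Longrightarrow> (p0 (of_real s), vcnj (p0 (of_real s))) \<in> V"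
  obtains \<rho> p a where
    "\<And>s. s \<in> I \<Longrightarrow> \<rho> s > 0" "\<And>s. s \<in> I \<Longrightarrow> {s - \<rho> s<..<s + \<rho> s} \<subseteq> I"
    "\<And>s z. s \<in> I \<Longrightarrow> z \<in> sq s (\<rho> s) \<Longrightarrow> (p z, vcnj (p z)) \<in> V"
    "\<And>s z i. s \<in> I \<Longrightarrow> z \<in> sq s (\<rho> s) \<Longrightarrow> ((\<lambda>z. p z $ i) has_derivative
       (\<lambda>h. a z $ i * h + F (p z, vcnj (p z)) $ i * cnj h)) (at z)"
    "\<And>s i. s \<in> I \<Longrightarrow> continuous_on (sq s (\<rho> s)) (\<lambda>z. a z $ i)"
    "\<And>s. s \<in> I \<Longrightarrow> p (of_real s) = p0 (of_real s)"
proof -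
  define near where "near s r u v \<longleftrightarrow> (\<forall>i. norm (u $ i - p0 (of_real s) $ i) \<le> r) \<and>
      (\<forall>i. norm (v $ i - cnj (p0 (of_real s) $ i)) \<le> r)" for s :: real and r and u v :: "complex^3"
  define ok where "ok s \<rho> e K \<longleftrightarrow> \<rho> > 0 \<and> e > 0 \<and> K > 0 \<and> sq s \<rho> \<subseteq> N \<and> {s - \<rho><..<s + \<rho>} \<subseteq> I \<and>
      (\<forall>z\<in>sq s \<rho>. \<forall>i. norm (p0 z $ i - p0 (of_real s) $ i) \<le> e / 2) \<and>
      (\<forall>u v. near s e u v \<longrightarrow> (u, v) \<in> V \<and> (\<forall>i. norm (F (u, v) $ i) \<le> K)) \<and>
      (\<forall>u v u' v' \<delta> i. near s e u v \<longrightarrow> near s e u' v' \<longrightarrow> (\<forall>i. norm (u $ i - u' $ i) \<le> \<delta>) \<longrightarrow>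
         (\<forall>i. norm (v $ i - v' $ i) \<le> \<delta>) \<longrightarrow> norm (F (u, v) $ i - F (u', v') $ i) \<le> K * \<delta>) \<and>
      4 * \<rho> * K \<le> e / 2 \<and> 4 * \<rho> * K \<le> 1 / 2" for s \<rho> e K
  have "\<exists>\<rho> e K. ok s \<rho> e K" if s: "s \<in> I" for s
  proof -
    define c where "c = (p0 (of_real s), vcnj (p0 (of_real s)))"
    have "\<exists>r K. r > 0 \<and> K > 0 \<and> cball c r \<subseteq> V \<and> (\<forall>x\<in>cball c r. norm (F x $ i) \<le> K) \<and>
        (\<forall>x\<in>cball c r. \<forall>y\<in>cball c r. norm (F x $ i - F y $ i) \<le> K * norm (x - y))" for i
      by (rule holomorphic_along_curves_locally_Lipschitz[OF V contF[of i] holF[of i] p0V[OF s, folded c_def]])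
         blast
    then obtain r K where rK: "\<And>i. r i > 0" "\<And>i. K i > 0" "\<And>i. cball c (r i) \<subseteq> V"
      "\<And>i x. x \<in> cball c (r i) \<Longrightarrow> norm (F x $ i) \<le> K i"
      "\<And>i x y. x \<in> cball c (r i) \<Longrightarrow> y \<in> cball c (r i) \<Longrightarrow> norm (F x $ i - F y $ i) \<le> K i * norm (x - y)"
      by metis
    define R where "R = Min (range r)"
    have R: "R > 0" "\<And>i. R \<le> r i" using rK(1) by (auto simp: R_def)
    define L where "L = Max (range K)"
    have L: "L > 0" "\<And>i. K i \<le> L" using rK(2) by (auto simp: L_def Max_gr_iff)
    \<comment> \<open>Two vectors with three components each: a distance of at most \<open>e\<close>
      in every component means at most \<open>6 * e\<close> in the product space.\<close>
    define e where "e = R / 6"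
    have e: "e > 0" using R by (simp add: e_def)
    have pair: "norm ((u, v) - (u', v')) \<le> 6 * \<delta>"
      if "\<And>i. norm (u $ i - u' $ i) \<le> \<delta>" "\<And>i. norm (v $ i - v' $ i) \<le> \<delta>" for u v u' v' :: "complex^3" and \<delta>
    proof -
      have "norm ((u, v) - (u', v')) \<le> norm (u - u') + norm (v - v')" by (simp add: norm_Pair_le)
      also have "\<dots> \<le> 3 * \<delta> + 3 * \<delta>" by (intro add_mono norm_le_3_componentwise) (use that in auto)
      finally show ?thesis by simp
    qed
    have near_c: "(u, v) \<in> cball c (r i)" if "near s e u v" for u v i
    proof -
      have "norm ((u, v) - c) \<le> 6 * e"
        unfolding c_def by (rule pair) (use that in \<open>auto simp: near_def vcnj_def\<close>)
      then show ?thesis using R(2)[of i] by (simp add: dist_norm norm_minus_commute e_def)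
    qed
    have "\<exists>d>0. ball (complex_of_real s) d \<subseteq> N \<and> ball s d \<subseteq> I \<and>
        (\<forall>z\<in>ball (of_real s) d. \<forall>i. norm (p0 z $ i - p0 (of_real s) $ i) \<le> e / 2)"
    proof -
      have sN: "complex_of_real s \<in> N" using N s by auto
      obtain d1 where d1: "d1 > 0" "ball (complex_of_real s) d1 \<subseteq> N"
        using N(1) sN open_contains_ball by blast
      obtain d2 where d2: "d2 > 0" "ball s d2 \<subseteq> I"
        using I s open_contains_ball by blast
      have "\<exists>d>0. \<forall>z. dist z (of_real s) < d \<longrightarrow> dist (p0 z $ i) (p0 (of_real s) $ i) < e / 2" for i
      proof -
        have "isCont (\<lambda>z. p0 z $ i) (of_real s)"
          using holomorphic_on_imp_continuous_on[OF p0, of i] sN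
          by (simp add: continuous_on_eq_continuous_at[OF N(1)])
        then show ?thesis
          unfolding continuous_at_eps_delta using e half_gt_zero by blast
      qed
      then obtain d3 where d3: "\<And>i. d3 i > 0"
        "\<And>i z. dist z (of_real s) < d3 i \<Longrightarrow> dist (p0 z $ i) (p0 (of_real s) $ i) < e / 2"
        by metis
      let ?d = "min (min d1 d2) (Min (range d3))"
      have "?d \<le> d3 i" for i by (auto intro: min.coboundedI2)
      moreover have "?d > 0" using d1 d2 d3(1) by auto
      ultimately show ?thesis
        using d1 d2 d3(2) by (intro exI[of _ ?d]) (fastforce simp: dist_commute dist_norm intro: less_imp_le)
    qed
    then obtain d where d: "d > 0" "ball (complex_of_real s) d \<subseteq> N" "ball s d \<subseteq> I"
        "\<And>z i. z \<in> ball (of_real s) d \<Longrightarrow> norm (p0 z $ i - p0 (of_real s) $ i) \<le> e / 2"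
      by blast
    \<comment> \<open>With Lipschitz constant \<open>6 * L\<close>, the product
      \<open>4 * \<rho> * (6 * L)\<close> has to stay below \<open>e / 2\<close> and below
      \<open>1 / 2\<close>, hence the 48. The bound \<open>d / 2\<close> puts the square inside the
      ball of radius \<open>d\<close>.\<close>
    define \<rho> where "\<rho> = min (d / 2) (min (e / (48 * L)) (1 / (48 * L)))"
    have \<rho>: "\<rho> > 0" "2 * \<rho> \<le> d" "\<rho> \<le> e / (48 * L)" "\<rho> \<le> 1 / (48 * L)"
      using d e L by (auto simp: \<rho>_def)
    have sqd: "z \<in> ball (of_real s) d" if "z \<in> sq s \<rho>" for z
      using that \<rho>(2) cmod_le[of "z - of_real s"] by (auto simp: sq_def dist_norm norm_minus_commute)
    have "ok s \<rho> e (6 * L)"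
      unfolding ok_def
    proof (intro conjI ballI allI impI)
      show "sq s \<rho> \<subseteq> N" using sqd d(2) by blast
      show "{s - \<rho><..<s + \<rho>} \<subseteq> I" using \<rho>(1,2) by (intro order_trans[OF _ d(3)]) (auto simp: dist_norm)
      show "norm (p0 z $ i - p0 (of_real s) $ i) \<le> e / 2" if "z \<in> sq s \<rho>" for z i
        using d(4) sqd that by blast
      show "(u, v) \<in> V" if "near s e u v" for u v
        using near_c[OF that] rK(3) by blast
      show "norm (F (u, v) $ i) \<le> 6 * L" if "near s e u v" for u v i
        using rK(4)[OF near_c[OF that]] L(1) L(2)[of i] by (smt (verit))
      show "norm (F (u, v) $ i - F (u', v') $ i) \<le> 6 * L * \<delta>"
        if "near s e u v" "near s e u' v'" "\<forall>i. norm (u $ i - u' $ i) \<le> \<delta>" "\<forall>i. norm (v $ i - v' $ i) \<le> \<delta>"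
        for u v u' v' \<delta> i
      proof -
        have "norm (F (u, v) $ i - F (u', v') $ i) \<le> K i * norm ((u, v) - (u', v'))"
          by (rule rK(5)) (use near_c that in auto)
        also have "\<dots> \<le> L * (6 * \<delta>)"
          using L rK(2)[of i] that pair[of u u' \<delta> v v'] by (intro mult_mono) auto
        finally show ?thesis by simp
      qed
    qed (use \<rho> e L in \<open>auto simp: field_simps\<close>)
    then show ?thesis by blast
  qed
  then obtain \<rho> e K where ok: "\<And>s. s \<in> I \<Longrightarrow> ok s (\<rho> s) (e s) (K s)" by metis
  interpret picard V F p0 I \<rho> e K
  proof
    fix s assume s: "s \<in> I"
    show "(\<lambda>z. p0 z $ i) holomorphic_on sq s (\<rho> s)" for i
      using p0 by (rule holomorphic_on_subset) (use ok[OF s] in \<open>simp add: ok_def\<close>)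
  qed (use ok V contF holF in \<open>auto simp: ok_def near_def\<close>)
  obtain p a where
    "\<And>s z. s \<in> I \<Longrightarrow> z \<in> sq s (\<rho> s) \<Longrightarrow> (p z, vcnj (p z)) \<in> V"
    "\<And>s z i. s \<in> I \<Longrightarrow> z \<in> sq s (\<rho> s) \<Longrightarrow> ((\<lambda>z. p z $ i) has_derivative
       (\<lambda>h. a z $ i * h + F (p z, vcnj (p z)) $ i * cnj h)) (at z)"
    "\<And>s i. s \<in> I \<Longrightarrow> continuous_on (sq s (\<rho> s)) (\<lambda>z. a z $ i)"
    "\<And>s. s \<in> I \<Longrightarrow> p (of_real s) = p0 (of_real s)"
    using solution by blast
  moreover have "\<rho> s > 0" "{s - \<rho> s<..<s + \<rho> s} \<subseteq> I" if "s \<in> I" for s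
    using ok[OF that] by (auto simp: ok_def)
  ultimately show ?thesis by (intro that[of \<rho> p a]) auto
qed

section \<open>Recovering a surface from its complex derivative\<close>

lemma d_s_eq: "d_s f z = f' 1" and d_t_eq: "d_t f z = f' \<i>"
  if f: "(f has_derivative f') (at z)"
proof -
  have 1: "((\<lambda>s. f (z + c * complex_of_real s)) has_vector_derivative f' c) (at 0)" for c
  proof -
    interpret bounded_linear f' using f by (rule has_derivative_bounded_linear)
    have "((\<lambda>s. z + c * complex_of_real s) has_derivative (\<lambda>h. c * of_real h)) (at 0)"
      by (auto intro!: derivative_eq_intros)
    then have "((\<lambda>s. f (z + c * complex_of_real s)) has_derivative (\<lambda>h. f' (c * of_real h))) (at 0)"
      by (rule has_derivative_compose) (use f in simp)
    moreover have "f' (c * of_real h) = h *\<^sub>R f' c" for h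
      using scaleR[of h c] by (simp add: scaleR_conv_of_real mult.commute)
    ultimately show ?thesis by (simp add: has_vector_derivative_def)
  qed
  show "d_s f z = f' 1"
    unfolding d_s_def using 1[of 1] by (intro vector_derivative_at) simp
  show "d_t f z = f' \<i>"
    unfolding d_t_def using 1[of \<i>] by (intro vector_derivative_at) simp
qed

lemma Complex_in_sq: "Complex x y \<in> sq s \<rho> \<longleftrightarrow> x \<in> {s - \<rho><..<s + \<rho>} \<and> y \<in> {-\<rho><..<\<rho>}"
  by (auto simp: sq_def)

text \<open>The closed form \<open>X ds + Y dt\<close> is integrated along vertical segments, which puts the
  prescribed curve on the real axis.\<close>

lemma potential_on_square:
  fixes X Y Xs Xt Yt :: "complex \<Rightarrow> 'a::euclidean_space" and \<beta> :: "real \<Rightarrow> 'a"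
  assumes X: "\<And>z. z \<in> sq s \<rho> \<Longrightarrow> (X has_derivative (\<lambda>h. Re h *\<^sub>R Xs z + Im h *\<^sub>R Xt z)) (at z)"
    and Y: "\<And>z. z \<in> sq s \<rho> \<Longrightarrow> (Y has_derivative (\<lambda>h. Re h *\<^sub>R Xt z + Im h *\<^sub>R Yt z)) (at z)"
    and cont: "continuous_on (sq s \<rho>) Xt" "continuous_on (sq s \<rho>) Yt"
    and \<beta>: "\<And>x. x \<in> {s - \<rho><..<s + \<rho>} \<Longrightarrow> (\<beta> has_vector_derivative X (of_real x)) (at x)"
    and z: "z \<in> sq s \<rho>"
  defines "\<psi> \<equiv> \<lambda>z. \<beta> (Re z) + integral {0..1} (\<lambda>\<sigma>. Im z *\<^sub>R Y (Complex (Re z) (\<sigma> * Im z)))"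
  shows "(\<psi> has_derivative (\<lambda>h. Re h *\<^sub>R X z + Im h *\<^sub>R Y z)) (at z)"
proof -
  define A where "A = {s - \<rho><..<s + \<rho>}"
  define C where "C = {-\<rho><..<\<rho>}"
  \<comment> \<open>The vertical segment is rescaled to [0,1], so that the domain of integration
    does not depend on \<open>y\<close>.\<close>
  define f where "f x y \<sigma> = y *\<^sub>R Y (Complex x (\<sigma> * y))" for x y \<sigma>
  have inC: "\<sigma> * y \<in> C" if "y \<in> C" "\<sigma> \<in> {0..1}" for y \<sigma>
  proof -
    have "\<bar>\<sigma> * y\<bar> \<le> 1 * \<bar>y\<bar>" unfolding abs_mult using that by (intro mult_right_mono) auto
    then show ?thesis using that by (auto simp: C_def)
  qed
  have inS: "Complex x y \<in> sq s \<rho>" if "x \<in> A" "y \<in> C" for x y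
    using that by (simp add: A_def C_def Complex_in_sq)
  have contY: "continuous_on (sq s \<rho>) Y" "continuous_on (sq s \<rho>) X"
    by (intro continuous_at_imp_continuous_on ballI has_derivative_continuous[OF Y] has_derivative_continuous[OF X]; assumption)+
  have cc: "continuous_on (U \<times> cbox 0 1) (\<lambda>q. g (Complex (u (fst q)) (snd q * v (fst q))))"
    if g: "continuous_on (sq s \<rho>) g" and u: "continuous_on U u" "continuous_on U v" "u ` U \<subseteq> A" "v ` U \<subseteq> C"
    for U :: "real set" and u v and g :: "complex \<Rightarrow> 'a"
  proof (rule continuous_on_compose2[OF g])
    have "continuous_on (U \<times> cbox 0 1) (\<lambda>q. u (fst q))" "continuous_on (U \<times> cbox (0::real) 1) (\<lambda>q. v (fst q))"
      by (auto intro!: continuous_on_compose2[OF u(1)] continuous_on_compose2[OF u(2)] continuous_intros)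
    then show "continuous_on (U \<times> cbox 0 1) (\<lambda>q. Complex (u (fst q)) (snd q * v (fst q)))"
      unfolding Complex_eq by (intro continuous_intros)
    show "(\<lambda>q. Complex (u (fst q)) (snd q * v (fst q))) ` (U \<times> cbox 0 1) \<subseteq> sq s \<rho>"
      using u(3,4) by (auto intro!: inS inC)
  qed
  have slice: "((\<lambda>t. g (Complex (c + t * d) (a + t * b))) has_vector_derivative d *\<^sub>R gs + b *\<^sub>R gt) (at t)"
    if "(g has_derivative (\<lambda>h. Re h *\<^sub>R gs + Im h *\<^sub>R gt)) (at (Complex (c + t * d) (a + t * b)))"
    for g :: "complex \<Rightarrow> 'a" and gs gt a b c d t
  proof -
    have "((\<lambda>t. Complex (c + t * d) (a + t * b)) has_derivative (\<lambda>h. Complex (h * d) (h * b))) (at t)"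
      unfolding Complex_eq by (auto intro!: derivative_eq_intros simp: algebra_simps)
    from has_derivative_compose[OF this that]
    show ?thesis by (simp add: has_vector_derivative_def scaleR_add_right)
  qed
  have int: "f x y integrable_on cbox 0 1" if "x \<in> A" "y \<in> C" for x y
  proof (rule integrable_continuous)
    have "continuous_on (UNIV \<times> cbox 0 1) (\<lambda>q :: real \<times> real. Y (Complex x (snd q * y)))"
      using cc[OF contY(1), of UNIV "\<lambda>_. x" "\<lambda>_. y"] that by (simp add: image_subset_iff)
    then have "continuous_on (cbox 0 1) (\<lambda>\<sigma>. (\<lambda>q :: real \<times> real. Y (Complex x (snd q * y))) (0, \<sigma>))"
      by (rule continuous_on_compose2) (auto intro!: continuous_intros)
    then show "continuous_on (cbox 0 1) (f x y)" unfolding f_def by (intro continuous_intros) simp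
  qed
  have dx: "((\<lambda>x. integral {0..1} (f x y)) has_vector_derivative X (Complex x y) - X (of_real x)) (at x within A)"
    if xy: "x \<in> A" "y \<in> C" for x y
  proof -
    have lz: "((\<lambda>x. integral (cbox 0 1) (f x y)) has_vector_derivative
        integral (cbox 0 1) (\<lambda>\<sigma>. y *\<^sub>R Xt (Complex x (\<sigma> * y)))) (at x within A)"
    proof (rule leibniz_rule_vector_derivative)
      fix x \<sigma> :: real assume "x \<in> A" "\<sigma> \<in> cbox 0 1"
      then have "Complex x (\<sigma> * y) \<in> sq s \<rho>" using xy by (auto intro!: inS inC)
      from slice[of Y "Xt (Complex x (\<sigma> * y))" "Yt (Complex x (\<sigma> * y))" 0 x 1 "\<sigma> * y" 0] Y[OF this]
      have "((\<lambda>x. Y (Complex x (\<sigma> * y))) has_vector_derivative Xt (Complex x (\<sigma> * y))) (at x within A)"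
        by (simp add: has_vector_derivative_at_within)
      then show "((\<lambda>x. f x y \<sigma>) has_vector_derivative y *\<^sub>R Xt (Complex x (\<sigma> * y))) (at x within A)"
        unfolding f_def by (rule bounded_linear.has_vector_derivative[OF bounded_linear_scaleR_right])
    next
      show "continuous_on (A \<times> cbox 0 1) (\<lambda>(x, \<sigma>). y *\<^sub>R Xt (Complex x (\<sigma> * y)))"
        unfolding case_prod_unfold
        using cc[OF cont(1), of A "\<lambda>x. x" "\<lambda>_. y"] xy by (intro continuous_intros) (simp add: image_subset_iff)
    qed (use xy int in \<open>auto simp: A_def\<close>)
    \<comment> \<open>Closedness enters here: \<open>Xt\<close> is the \<open>s\<close>-derivative
      of \<open>Y\<close> and also the \<open>t\<close>-derivative of \<open>X\<close>, so the
      differentiated integral has \<open>X\<close> as a primitive along the segment. The lower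
      boundary term \<open>X (of_real x)\<close> will cancel against the derivative of
      \<open>\<beta>\<close>.\<close>
    have "((\<lambda>\<sigma>. y *\<^sub>R Xt (Complex x (\<sigma> * y))) has_integral X (Complex x (1 * y)) - X (Complex x (0 * y))) {0..1}"
    proof (rule fundamental_theorem_of_calculus)
      fix \<sigma> :: real assume "\<sigma> \<in> {0..1}"
      then have "Complex x (\<sigma> * y) \<in> sq s \<rho>" using xy by (auto intro!: inS inC)
      from slice[of X "Xs (Complex x (\<sigma> * y))" "Xt (Complex x (\<sigma> * y))" x \<sigma> 0 0 y] X[OF this]
      show "((\<lambda>\<sigma>. X (Complex x (\<sigma> * y))) has_vector_derivative y *\<^sub>R Xt (Complex x (\<sigma> * y))) (at \<sigma> within {0..1})"
        by (simp add: has_vector_derivative_at_within)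
    qed simp
    then have I: "integral (cbox 0 1) (\<lambda>\<sigma>. y *\<^sub>R Xt (Complex x (\<sigma> * y))) = X (Complex x (1 * y)) - X (Complex x (0 * y))"
      unfolding cbox_interval by (rule integral_unique)
    show ?thesis using lz unfolding I by (simp add: complex_of_real_def)
  qed
  have dy: "((\<lambda>y. integral {0..1} (f x y)) has_vector_derivative Y (Complex x y)) (at y within C)"
    if xy: "x \<in> A" "y \<in> C" for x y
  proof -
    have dY: "((\<lambda>t. Y (Complex x (\<sigma> * t))) has_vector_derivative \<sigma> *\<^sub>R Yt (Complex x (\<sigma> * y))) (at y)"
      if "Complex x (\<sigma> * y) \<in> sq s \<rho>" for \<sigma> y :: real
      using slice[of Y "Xt (Complex x (\<sigma> * y))" "Yt (Complex x (\<sigma> * y))" x y 0 0 \<sigma>] Y[OF that]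
      by (simp add: mult.commute)
    have lz: "((\<lambda>y. integral (cbox 0 1) (f x y)) has_vector_derivative
        integral (cbox 0 1) (\<lambda>\<sigma>. Y (Complex x (\<sigma> * y)) + (\<sigma> * y) *\<^sub>R Yt (Complex x (\<sigma> * y)))) (at y within C)"
    proof (rule leibniz_rule_vector_derivative)
      fix y \<sigma> :: real assume "y \<in> C" "\<sigma> \<in> cbox 0 1"
      then have "Complex x (\<sigma> * y) \<in> sq s \<rho>" using xy by (auto intro!: inS inC)
      from has_vector_derivative_scaleR[OF DERIV_ident has_vector_derivative_at_within[OF dY[OF this]]]
      have "((\<lambda>y. y *\<^sub>R Y (Complex x (\<sigma> * y))) has_vector_derivative
          y *\<^sub>R (\<sigma> *\<^sub>R Yt (Complex x (\<sigma> * y))) + 1 *\<^sub>R Y (Complex x (\<sigma> * y))) (at y within C)"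
        .
      then show "((\<lambda>y. f x y \<sigma>) has_vector_derivative
          Y (Complex x (\<sigma> * y)) + (\<sigma> * y) *\<^sub>R Yt (Complex x (\<sigma> * y))) (at y within C)"
        by (simp add: f_def algebra_simps)
    next
      show "continuous_on (C \<times> cbox 0 1) (\<lambda>(y, \<sigma>). Y (Complex x (\<sigma> * y)) + (\<sigma> * y) *\<^sub>R Yt (Complex x (\<sigma> * y)))"
        unfolding case_prod_unfold
        using cc[OF contY(1), of C "\<lambda>_. x" "\<lambda>y. y"] cc[OF cont(2), of C "\<lambda>_. x" "\<lambda>y. y"] xy
        by (intro continuous_intros) (simp_all add: image_subset_iff)
    qed (use xy int in \<open>auto simp: C_def\<close>)
    \<comment> \<open>By the product rule the integrand is the \<open>\<sigma>\<close>-derivative of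
      \<open>\<sigma> *\<^sub>R Y (Complex x (\<sigma> * y))\<close>.\<close>
    have "((\<lambda>\<sigma>. Y (Complex x (\<sigma> * y)) + (\<sigma> * y) *\<^sub>R Yt (Complex x (\<sigma> * y))) has_integral
        1 *\<^sub>R Y (Complex x (1 * y)) - 0 *\<^sub>R Y (Complex x (0 * y))) {0..1}"
    proof (rule fundamental_theorem_of_calculus)
      fix \<sigma> :: real assume "\<sigma> \<in> {0..1}"
      then have "Complex x (\<sigma> * y) \<in> sq s \<rho>" using xy by (auto intro!: inS inC)
      from slice[of Y "Xt (Complex x (\<sigma> * y))" "Yt (Complex x (\<sigma> * y))" x \<sigma> 0 0 y] Y[OF this]
      have "((\<lambda>\<sigma>. Y (Complex x (\<sigma> * y))) has_vector_derivative y *\<^sub>R Yt (Complex x (\<sigma> * y))) (at \<sigma> within {0..1})"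
        by (simp add: has_vector_derivative_at_within)
      from has_vector_derivative_scaleR[OF DERIV_ident this] have "((\<lambda>\<sigma>. \<sigma> *\<^sub>R Y (Complex x (\<sigma> * y))) has_vector_derivative
          \<sigma> *\<^sub>R (y *\<^sub>R Yt (Complex x (\<sigma> * y))) + 1 *\<^sub>R Y (Complex x (\<sigma> * y))) (at \<sigma> within {0..1})"
        .
      then show "((\<lambda>\<sigma>. \<sigma> *\<^sub>R Y (Complex x (\<sigma> * y))) has_vector_derivative
          Y (Complex x (\<sigma> * y)) + (\<sigma> * y) *\<^sub>R Yt (Complex x (\<sigma> * y))) (at \<sigma> within {0..1})"
        by (simp add: algebra_simps)
    qed simp
    then have I: "integral (cbox 0 1) (\<lambda>\<sigma>. Y (Complex x (\<sigma> * y)) + (\<sigma> * y) *\<^sub>R Yt (Complex x (\<sigma> * y))) = Y (Complex x y)"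
      by (simp add: integral_unique)
    show ?thesis using lz unfolding I by simp
  qed
  have zAC: "Re z \<in> A" "Im z \<in> C" using z by (auto simp: A_def C_def sq_def)
  let ?g = "\<lambda>x y. \<beta> x + integral {0..1} (f x y)"
  have "((\<lambda>(x, y). ?g x y) has_derivative
      (\<lambda>(tx, ty). tx *\<^sub>R X z + blinfun_apply ((\<lambda>x y. blinfun_scaleR_left (Y (Complex x y))) (Re z) (Im z)) ty))
      (at (Re z, Im z) within A \<times> C)"
  proof (rule has_derivative_partialsI)
    have "((\<lambda>x. ?g x (Im z)) has_vector_derivative X (of_real (Re z)) + (X z - X (of_real (Re z)))) (at (Re z) within A)"
      using dx[OF zAC] \<beta>[of "Re z"] zAC(1)
      by (intro has_vector_derivative_add) (simp_all add: A_def has_vector_derivative_at_within)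
    then show "((\<lambda>x. ?g x (Im z)) has_derivative (\<lambda>tx. tx *\<^sub>R X z)) (at (Re z) within A)"
      by (simp add: has_vector_derivative_def)
    show "(?g x has_derivative blinfun_apply (blinfun_scaleR_left (Y (Complex x y)))) (at y within C)"
      if "x \<in> A" "y \<in> C" for x y
      using has_vector_derivative_add[OF has_vector_derivative_const dy[OF that], of "\<beta> x"]
      by (simp add: has_vector_derivative_def)
    have "continuous_on (A \<times> C) (\<lambda>q. Y (Complex (fst q) (snd q)))"
      by (rule continuous_on_compose2[OF contY(1)])
         (auto simp: Complex_eq inS[unfolded Complex_eq] intro!: continuous_intros)
    then have "continuous_on (A \<times> C) (\<lambda>q. blinfun_scaleR_left (Y (Complex (fst q) (snd q))))"
      by (intro bounded_linear.continuous_on[OF bounded_linear_blinfun_scaleR_left])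
    then show "continuous (at (Re z, Im z) within A \<times> C) (\<lambda>(x, y). blinfun_scaleR_left (Y (Complex x y)))"
      using zAC by (simp add: continuous_on_eq_continuous_within case_prod_unfold)
  qed (use zAC in \<open>auto simp: C_def\<close>)
  moreover have "at (Re z, Im z) within A \<times> C = at (Re z, Im z)"
    using zAC by (intro at_within_open open_Times) (auto simp: A_def C_def)
  ultimately have "((\<lambda>(x, y). ?g x y) has_derivative (\<lambda>(tx, ty). tx *\<^sub>R X z + ty *\<^sub>R Y z)) (at (Re z, Im z))"
    by simp
  moreover have "((\<lambda>z. (Re z, Im z)) has_derivative (\<lambda>h. (Re h, Im h))) (at z)"
    by (intro has_derivative_Pair bounded_linear.has_derivative[OF bounded_linear_Re]
          bounded_linear.has_derivative[OF bounded_linear_Im] has_derivative_ident)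
  ultimately have "((\<lambda>z. (\<lambda>(x, y). ?g x y) (Re z, Im z)) has_derivative
      (\<lambda>h. (\<lambda>(tx, ty). tx *\<^sub>R X z + ty *\<^sub>R Y z) (Re h, Im h))) (at z)"
    using has_derivative_compose[of "\<lambda>z. (Re z, Im z)" "\<lambda>h. (Re h, Im h)" z UNIV] by blast
  then show ?thesis by (simp only: \<psi>_def f_def[abs_def] prod.case)
qed

section \<open>Componentwise differentiation and the complex algebra of the tangent frame\<close>

lemma has_derivative_vec_componentwise:
  fixes f :: "'a::real_normed_vector \<Rightarrow> 'b::euclidean_space ^ 'n"
  assumes "\<And>i. ((\<lambda>x. f x $ i) has_derivative (\<lambda>h. f' h $ i)) (at x within S)"
  shows "(f has_derivative f') (at x within S)"
  unfolding has_derivative_componentwise_within[of f f']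
proof
  fix b :: "'b ^ 'n" assume "b \<in> Basis"
  then obtain i u where b: "b = axis i u" by (auto simp: Basis_vec_def)
  show "((\<lambda>x. f x \<bullet> b) has_derivative (\<lambda>h. f' h \<bullet> b)) (at x within S)"
    unfolding b inner_axis using assms[of i] by (rule has_derivative_inner_left)
qed

lemma has_derivative_cong_open:
  assumes "open S" "z \<in> S" "\<And>w. w \<in> S \<Longrightarrow> f w = g w" "(g has_derivative g') (at z)"
  shows "(f has_derivative g') (at z)"
  using assms by (auto intro: has_derivative_transform_within_open[of g g' z UNIV S f])

text \<open>Bilinear rather than Hermitian: this keeps it holomorphic in both arguments, and makes
  \<open>cdot p p = 0\<close> the condition for conformality.\<close>

definition cdot :: "complex^3 \<Rightarrow> complex^3 \<Rightarrow> complex" where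
  "cdot P Q = P$1 * Q$1 + P$2 * Q$2 + P$3 * Q$3"

definition cnormal :: "complex^3 \<Rightarrow> complex^3 \<Rightarrow> complex^3" where
  "cnormal P Q = (1 / (\<i> * cdot P Q)) *s ccross P Q"

text \<open>If \<open>p = \<psi>\<^sub>z\<close>, then \<open>\<psi>\<^sub>s = re2 p\<close>, \<open>\<psi>\<^sub>t = im2 p\<close>, and \<open>cnormal p (vcnj p)\<close> is the unit normal,
  since \<open>\<lambda>\<^sup>2 = 2 cdot p (vcnj p)\<close> for conformal \<open>\<psi>\<close>.\<close>

definition re2 :: "complex^3 \<Rightarrow> real^3" where
  "re2 p = (\<chi> i. 2 * Re (p $ i))"

definition im2 :: "complex^3 \<Rightarrow> real^3" where
  "im2 p = (\<chi> i. - 2 * Im (p $ i))"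

text \<open>The divisor is the mean of the two squared lengths, which equals lambda^2 only in the
  conformal case; without conformality the vector need not be a unit vector.\<close>

definition rnormal :: "complex^3 \<Rightarrow> real^3" where
  "rnormal p = (2 / (re2 p \<bullet> re2 p + im2 p \<bullet> im2 p)) *\<^sub>R cross3 (re2 p) (im2 p)"

lemma ccross_components:
  "ccross a b $ 1 = a$2 * b$3 - a$3 * b$2"
  "ccross a b $ 2 = a$3 * b$1 - a$1 * b$3"
  "ccross a b $ 3 = a$1 * b$2 - a$2 * b$1"
  by (simp_all add: ccross_def)

text \<open>With \<open>X = re2 p\<close> and \<open>Y = im2 p\<close> one has
  \<open>p = (X - \<i> Y) / 2\<close>, so the cross product with the conjugate is purely imaginary.
  Its factor \<open>\<i>\<close> cancels the one in \<open>cnormal\<close>, whose value is therefore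
  real.\<close>

lemma ccross_vcnj: "ccross p (vcnj p) = (\<i> / 2) *s cvec (cross3 (re2 p) (im2 p))"
  by (simp add: vec_eq_iff forall_3 ccross_components cross_components vcnj_def cvec_def re2_def im2_def
      complex_eq_iff)

lemma cdot_vcnj: "cdot p (vcnj p) = of_real ((re2 p \<bullet> re2 p + im2 p \<bullet> im2 p) / 4)"
  by (simp add: cdot_def vcnj_def re2_def im2_def inner_vec_def sum_3 complex_eq_iff)

text \<open>The real and imaginary parts are, up to constants, the two conformality
  conditions.\<close>

lemma cdot_self: "cdot p p = Complex ((re2 p \<bullet> re2 p - im2 p \<bullet> im2 p) / 4) (- (re2 p \<bullet> im2 p) / 2)"
  by (simp add: cdot_def re2_def im2_def inner_vec_def sum_3 complex_eq_iff)

lemma cnormal_vcnj: "cnormal p (vcnj p) = cvec (rnormal p)"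
proof -
  have *: "1 / (\<i> * complex_of_real (c / 4)) * (\<i> / 2 * x) = complex_of_real (2 / c) * x" for c x
    by (cases "c = 0") (simp_all add: field_simps)
  then show ?thesis
    unfolding cnormal_def rnormal_def cdot_vcnj ccross_vcnj
    by (simp only: vec_eq_iff cvec_def vector_smult_component vec_lambda_beta vector_scaleR_component
        real_scaleR_def of_real_mult * simp_thms)
qed

text \<open>Lagrange's identity: for orthogonal vectors of equal length the cross product has their
  squared length as its norm.\<close>

lemma norm_rnormal:
  assumes "re2 p \<bullet> re2 p = im2 p \<bullet> im2 p" "re2 p \<bullet> im2 p = 0" "re2 p \<bullet> re2 p > 0"
  shows "norm (rnormal p) = 1"
proof -
  let ?E = "re2 p \<bullet> re2 p"
  have "(norm (cross3 (re2 p) (im2 p)))\<^sup>2 = (norm (re2 p))\<^sup>2 * (norm (im2 p))\<^sup>2 - (re2 p \<bullet> im2 p)\<^sup>2"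
    by (rule norm_cross)
  also have "\<dots> = ?E\<^sup>2"
    unfolding power2_norm_eq_inner assms(2) assms(1)[symmetric] by (simp add: power2_eq_square)
  finally have "norm (cross3 (re2 p) (im2 p)) = ?E"
    using assms(3) by (simp add: power2_eq_iff_nonneg)
  then show ?thesis using assms by (simp add: rnormal_def)
qed

lemma linear_cvec: "linear cvec"
  by (rule linearI) (simp_all add: cvec_def vec_eq_iff scaleR_conv_of_real[where 'a=complex])

text \<open>All derivatives of \<open>\<psi>\<close> up to second order are read off from
  \<open>p\<close> and its two Wirtinger derivatives \<open>a\<close> and \<open>k\<close>. As
  \<open>k\<close> is real, it drops out of both mixed derivatives, which agree, and enters the two
  pure ones with the same sign.\<close>

lemma surface_calculus:
  assumes \<Omega>: "open \<Omega>" "z \<in> \<Omega>"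
    and \<psi>: "\<And>z. z \<in> \<Omega> \<Longrightarrow> (\<psi> has_derivative (\<lambda>h. Re h *\<^sub>R re2 (p z) + Im h *\<^sub>R im2 (p z))) (at z)"
    and p: "\<And>z i. z \<in> \<Omega> \<Longrightarrow> ((\<lambda>z. p z $ i) has_derivative
       (\<lambda>h. a z $ i * h + of_real (k z $ i) * cnj h)) (at z)"
  shows "d_s \<psi> z = re2 (p z)" "d_t \<psi> z = im2 (p z)"
    and "wz (cvec \<circ> \<psi>) z = p z" "wzb (cvec \<circ> \<psi>) z = vcnj (p z)"
    and "wz (wzb (cvec \<circ> \<psi>)) z = cvec (k z)"
    and "d_s \<psi> differentiable (at z)" "d_t \<psi> differentiable (at z)"
    and "d_s (d_s \<psi>) z = (\<chi> i. 2 * Re (a z $ i) + 2 * k z $ i)"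
    and "d_s (d_t \<psi>) z = (\<chi> i. - 2 * Im (a z $ i))"
    and "d_t (d_s \<psi>) z = (\<chi> i. - 2 * Im (a z $ i))"
    and "d_t (d_t \<psi>) z = (\<chi> i. - 2 * Re (a z $ i) + 2 * k z $ i)"
proof -
  have ds: "d_s \<psi> z = re2 (p z)" and dt: "d_t \<psi> z = im2 (p z)" if "z \<in> \<Omega>" for z
    using d_s_eq[OF \<psi>[OF that]] d_t_eq[OF \<psi>[OF that]] by simp_all
  have cpsi: "(cvec \<circ> \<psi> has_derivative (\<lambda>h. cvec (Re h *\<^sub>R re2 (p z) + Im h *\<^sub>R im2 (p z)))) (at z)" if "z \<in> \<Omega>" for z
    unfolding o_def using \<psi>[OF that]
    by (rule bounded_linear.has_derivative[OF linear_cvec[unfolded linear_conv_bounded_linear]])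
  have wz: "wz (cvec \<circ> \<psi>) z = p z" and wzb: "wzb (cvec \<circ> \<psi>) z = vcnj (p z)" if "z \<in> \<Omega>" for z
    using d_s_eq[OF cpsi[OF that]] d_t_eq[OF cpsi[OF that]]
    by (simp_all add: wz_def wzb_def vec_eq_iff cvec_def re2_def im2_def vcnj_def complex_eq_iff)
  have dX: "(d_s \<psi> has_derivative (\<lambda>h. \<chi> i. 2 * Re (a z $ i * h + of_real (k z $ i) * cnj h))) (at z)"
    by (rule has_derivative_cong_open[OF \<Omega> ds], assumption, rule has_derivative_vec_componentwise)
       (auto simp: re2_def intro!: derivative_eq_intros p \<Omega>)
  have dY: "(d_t \<psi> has_derivative (\<lambda>h. \<chi> i. - 2 * Im (a z $ i * h + of_real (k z $ i) * cnj h))) (at z)"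
    by (rule has_derivative_cong_open[OF \<Omega> dt], assumption, rule has_derivative_vec_componentwise)
       (auto simp: im2_def intro!: derivative_eq_intros p \<Omega>)
  have dw: "(wzb (cvec \<circ> \<psi>) has_derivative (\<lambda>h. \<chi> i. cnj (a z $ i * h + of_real (k z $ i) * cnj h))) (at z)"
    by (rule has_derivative_cong_open[OF \<Omega> wzb], assumption, rule has_derivative_vec_componentwise)
       (auto simp: vcnj_def simp del: complex_cnj_add complex_cnj_mult intro!: derivative_eq_intros p \<Omega>)
  show "d_s \<psi> z = re2 (p z)" "d_t \<psi> z = im2 (p z)"
    "wz (cvec \<circ> \<psi>) z = p z" "wzb (cvec \<circ> \<psi>) z = vcnj (p z)"
    using ds dt wz wzb \<Omega>(2) by simp_all
  show "wz (wzb (cvec \<circ> \<psi>)) z = cvec (k z)"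
    unfolding wz_def[of "wzb (cvec \<circ> \<psi>)"] d_s_eq[OF dw] d_t_eq[OF dw]
    by (simp add: vec_eq_iff cvec_def complex_eq_iff add_divide_distrib diff_divide_distrib)
  show "d_s \<psi> differentiable (at z)" "d_t \<psi> differentiable (at z)"
    using dX dY unfolding differentiable_def by blast+
  show "d_s (d_s \<psi>) z = (\<chi> i. 2 * Re (a z $ i) + 2 * k z $ i)"
    "d_s (d_t \<psi>) z = (\<chi> i. - 2 * Im (a z $ i))"
    "d_t (d_s \<psi>) z = (\<chi> i. - 2 * Im (a z $ i))"
    "d_t (d_t \<psi>) z = (\<chi> i. - 2 * Re (a z $ i) + 2 * k z $ i)"
    unfolding d_s_eq[OF dX] d_t_eq[OF dX] d_s_eq[OF dY] d_t_eq[OF dY]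
    by (simp_all add: vec_eq_iff)
qed

text \<open>An extension that is real on the real axis has a real derivative there. Hence the real
  and imaginary parts of the initial value \<open>p0\<close> separate into the derivative of
  \<open>\<beta>\<close> and \<open>B\<close> on the axis.\<close>

lemma has_real_derivative_holomorphic_extension:
  assumes g: "g holomorphic_on N" "open N" and s: "complex_of_real s \<in> N"
    and gf: "\<And>x. complex_of_real x \<in> N \<Longrightarrow> g (of_real x) = of_real (f x)"
  shows "(f has_real_derivative Re (deriv g (of_real s))) (at s)" "Im (deriv g (of_real s)) = 0"
proof -
  let ?D = "deriv g (of_real s)"
  have oN: "open (complex_of_real -` N)" using g(2) by (intro open_vimage continuous_intros)
  have "(g has_field_derivative ?D) (at (of_real s))"
    using g s by (rule holomorphic_derivI)
  then have "((\<lambda>x. g (of_real x)) has_vector_derivative ?D) (at s)"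
    by (rule has_vector_derivative_real_field)
  then have d: "((\<lambda>x. complex_of_real (f x)) has_vector_derivative ?D) (at s)"
    by (rule has_vector_derivative_transform_within_open[OF _ oN]) (use s gf in auto)
  from bounded_linear.has_vector_derivative[OF bounded_linear_Re d]
  show "(f has_real_derivative Re ?D) (at s)" by (simp add: has_real_derivative_iff_has_vector_derivative)
  from bounded_linear.has_vector_derivative[OF bounded_linear_Im d]
  have "((\<lambda>x. 0) has_vector_derivative Im ?D) (at s)" by simp
  then show "Im ?D = 0"
    using vector_derivative_at vector_derivative_const_at by metis
qed

lemma real_analytic_curve_extension:
  assumes "real_analytic_curve I f"
  obtains N h where "open N" "complex_of_real ` I \<subseteq> N" "\<And>i :: 3. (h i) holomorphic_on N"
    "\<And>i x. complex_of_real x \<in> N \<Longrightarrow> h i (of_real x) = of_real (f x $ i)"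
proof -
  have "\<exists>N g. open N \<and> complex_of_real ` I \<subseteq> N \<and> g holomorphic_on N \<and>
      (\<forall>x. complex_of_real x \<in> N \<longrightarrow> g (of_real x) = of_real (f x $ i))" for i
  proof -
    have "\<forall>s\<in>I. \<exists>r>0. \<exists>c. \<forall>x\<in>ball s r. (\<lambda>n. (x - s) ^ n * c n) sums (f x $ i)"
    proof
      fix s assume "s \<in> I"
      then obtain r c where r: "r > 0" "\<And>x. x \<in> ball s r \<Longrightarrow> (\<lambda>n. (x - s) ^ n *\<^sub>R c n) sums f x"
        using assms unfolding real_analytic_curve_def by blast
      have "(\<lambda>n. (x - s) ^ n * c n $ i) sums (f x $ i)" if "x \<in> ball s r" for x
        using bounded_linear.sums[OF bounded_linear_vec_nth r(2)[OF that], of i] by simp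
      then show "\<exists>r>0. \<exists>c. \<forall>x\<in>ball s r. (\<lambda>n. (x - s) ^ n * c n) sums (f x $ i)"
        using r(1) by (intro exI[of _ r] exI[of _ "\<lambda>n. c n $ i"] conjI ballI)
    qed
    then show ?thesis by (rule real_analytic_holomorphic_extension) blast
  qed
  then obtain N h where *: "\<And>i. open (N i)" "\<And>i. complex_of_real ` I \<subseteq> N i" "\<And>i. h i holomorphic_on N i"
      "\<And>i x. complex_of_real x \<in> N i \<Longrightarrow> h i (of_real x) = of_real (f x $ i)"
    by metis
  show ?thesis
  proof (rule that[of "\<Inter>i. N i" h])
    show "open (\<Inter>i. N i)" using *(1) by (intro open_INT) auto
    show "h i holomorphic_on (\<Inter>i. N i)" for i by (rule holomorphic_on_subset[OF *(3)]) blast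
    show "complex_of_real ` I \<subseteq> (\<Inter>i. N i)" using *(2) by (intro INT_greatest)
    show "h i (of_real x) = of_real (f x $ i)" if "complex_of_real x \<in> (\<Inter>i. N i)" for i x
      using that by (intro *(4)) simp
  qed
qed

section \<open>The Bjoerling problem\<close>

text \<open>For \<open>p = \<psi>\<^sub>z\<close> this real vector is the right-hand side of the equation.\<close>

definition curvature_term :: "(real^3 \<Rightarrow> real) \<Rightarrow> complex^3 \<Rightarrow> real^3" where
  "curvature_term g q = (g (rnormal q) / 2) *\<^sub>R cross3 (re2 q) (im2 q)"

text \<open>The surface before conformality is known. The equation is stated with the extension
  \<open>g\<close>, because \<open>rnormal (p z)\<close> is so far only known to lie where the
  holomorphic extension of \<open>g\<close> is defined, not on the sphere.\<close>

lemma bjorling_surface: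
  assumes g: "real_analytic_on3 U g" "sphere2 \<subseteq> U"
    and I: "open I" and bj: "bjorling_data I \<beta> B"
  obtains \<rho> \<psi> p a where
    "\<And>s. s \<in> I \<Longrightarrow> \<rho> s > 0" "\<And>s. s \<in> I \<Longrightarrow> {s - \<rho> s<..<s + \<rho> s} \<subseteq> I"
    "\<And>s z. s \<in> I \<Longrightarrow> z \<in> sq s (\<rho> s) \<Longrightarrow>
       (\<psi> has_derivative (\<lambda>h. Re h *\<^sub>R re2 (p z) + Im h *\<^sub>R im2 (p z))) (at z)"
    "\<And>s z i. s \<in> I \<Longrightarrow> z \<in> sq s (\<rho> s) \<Longrightarrow> ((\<lambda>z. p z $ i) has_derivative (\<lambda>h. a z $ i * h +
       of_real (curvature_term g (p z) $ i) * cnj h)) (at z)"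
    "\<And>s i. s \<in> I \<Longrightarrow> continuous_on (sq s (\<rho> s)) (\<lambda>z. a z $ i)"
    "\<And>s i. s \<in> I \<Longrightarrow> continuous_on (sq s (\<rho> s))
       (\<lambda>z. curvature_term g (p z) $ i)"
    "\<And>s z. s \<in> I \<Longrightarrow> z \<in> sq s (\<rho> s) \<Longrightarrow> re2 (p z) \<bullet> re2 (p z) + im2 (p z) \<bullet> im2 (p z) > 0"
    "\<And>s. s \<in> I \<Longrightarrow> \<psi> (of_real s) = \<beta> s"
    "\<And>s. s \<in> I \<Longrightarrow> re2 (p (of_real s)) = vector_derivative \<beta> (at s)"
    "\<And>s. s \<in> I \<Longrightarrow> im2 (p (of_real s)) = B s"
proof -
  obtain VG and G :: "complex^3 \<Rightarrow> complex" where VG: "open VG" "\<And>x. x \<in> U \<Longrightarrow> cvec x \<in> VG" "continuous_on VG G"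
    "\<And>x. cvec x \<in> VG \<Longrightarrow> G (cvec x) = of_real (g x)"
    "\<forall>S u. open S \<longrightarrow> (\<forall>i. (\<lambda>z. u z $ i) holomorphic_on S) \<longrightarrow> (\<forall>z\<in>S. u z \<in> VG) \<longrightarrow>
       (\<lambda>z. G (u z)) holomorphic_on S"
    by (rule real_analytic_on3_holomorphic_extension[OF g(1)]) (rule that; (assumption | blast))
  have curves: "real_analytic_curve I \<beta>" "real_analytic_curve I B"
    using bj by (auto simp: bjorling_data_def)
  obtain N1 b where N1: "open N1" "complex_of_real ` I \<subseteq> N1" "\<And>i :: 3. (b i) holomorphic_on N1"
    "\<And>i x. complex_of_real x \<in> N1 \<Longrightarrow> b i (of_real x) = of_real (\<beta> x $ i)"
    by (rule real_analytic_curve_extension[OF curves(1)]) (rule that; (assumption | blast))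
  obtain N2 c where N2: "open N2" "complex_of_real ` I \<subseteq> N2" "\<And>i :: 3. (c i) holomorphic_on N2"
    "\<And>i x. complex_of_real x \<in> N2 \<Longrightarrow> c i (of_real x) = of_real (B x $ i)"
    by (rule real_analytic_curve_extension[OF curves(2)]) (rule that; (assumption | blast))
  define p0 :: "complex \<Rightarrow> complex^3" where "p0 z = (\<chi> i. (deriv (b i) z - \<i> * c i z) / 2)" for z
  have p0_hol: "(\<lambda>z. p0 z $ i) holomorphic_on (N1 \<inter> N2)" for i
    unfolding p0_def vec_lambda_beta
    by (intro holomorphic_intros holomorphic_on_subset[OF holomorphic_deriv[OF N1(3) N1(1)]]
        holomorphic_on_subset[OF N2(3)]) auto
  have vd: "(\<beta> has_vector_derivative vector_derivative \<beta> (at s)) (at s)"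
      "re2 (p0 (of_real s)) = vector_derivative \<beta> (at s)" "im2 (p0 (of_real s)) = B s" if s: "s \<in> I" for s
  proof -
    have sN: "complex_of_real s \<in> N1" "complex_of_real s \<in> N2" using s N1(2) N2(2) by auto
    note d = has_real_derivative_holomorphic_extension[OF N1(3) N1(1) sN(1) N1(4)]
    have "(\<beta> has_derivative (\<lambda>h. h *\<^sub>R (\<chi> i. Re (deriv (b i) (of_real s))))) (at s)"
      by (rule has_derivative_vec_componentwise)
         (use d(1) in \<open>simp add: has_field_derivative_def mult_commute_abs\<close>)
    then have h: "(\<beta> has_vector_derivative (\<chi> i. Re (deriv (b i) (of_real s)))) (at s)"
      by (simp add: has_vector_derivative_def)
    then show "(\<beta> has_vector_derivative vector_derivative \<beta> (at s)) (at s)"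
      by (simp add: vector_derivative_at)
    show "re2 (p0 (of_real s)) = vector_derivative \<beta> (at s)" "im2 (p0 (of_real s)) = B s"
      using vector_derivative_at[OF h] d(2) N2(4)[OF sN(2)]
      by (simp_all add: re2_def im2_def p0_def vec_eq_iff)
  qed
  \<comment> \<open>The set where \<open>F\<close> is meaningful: the denominator of
    \<open>cnormal\<close> is nonzero and its value lies in the domain of \<open>G\<close>.\<close>
  define V where "V = {q. cdot (fst q) (snd q) \<noteq> 0 \<and> cnormal (fst q) (snd q) \<in> VG}"
  define F where "F q = (- \<i> * G (cnormal (fst q) (snd q))) *s ccross (fst q) (snd q)" for q
  have cont_cdot: "continuous_on UNIV (\<lambda>q. cdot (fst q) (snd q))"
    unfolding cdot_def by (intro continuous_intros)
  have cont_ccross: "continuous_on S (\<lambda>q. ccross (fst q) (snd q) $ i)" for S i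
    using exhaust_3[of i] by (elim disjE; hypsubst; unfold ccross_components; intro continuous_intros)
  have cont_cnormal: "continuous_on {q. cdot (fst q) (snd q) \<noteq> 0} (\<lambda>q. cnormal (fst q) (snd q))"
    by (rule continuous_on_componentwise_vec)
       (auto simp: cnormal_def intro!: continuous_intros cont_ccross continuous_on_subset[OF cont_cdot])
  have oV: "open V"
  proof -
    have "open {q :: (complex^3) \<times> (complex^3). cdot (fst q) (snd q) \<noteq> 0}"
      by (intro open_Collect_neq cont_cdot continuous_intros)
    from continuous_open_preimage[OF cont_cnormal this VG(1)]
    show ?thesis by (simp add: V_def Collect_conj_eq vimage_def)
  qed
  have contF: "continuous_on V (\<lambda>x. F x $ i)" for i
    unfolding F_def vector_smult_component
    by (intro continuous_intros cont_ccross continuous_on_compose2[OF VG(3)]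
          continuous_on_subset[OF cont_cnormal]) (auto simp: V_def)
  have holF: "holomorphic_along_curves V (\<lambda>x. F x $ i)" for i
    unfolding holomorphic_along_curves_def
  proof (intro allI impI)
    fix S and u v :: "complex \<Rightarrow> complex^3"
    assume S: "open S" and u: "\<forall>i. (\<lambda>x. u x $ i) holomorphic_on S" and v: "\<forall>i. (\<lambda>x. v x $ i) holomorphic_on S"
      and V: "\<forall>x\<in>S. (u x, v x) \<in> V"
    have cr: "(\<lambda>x. ccross (u x) (v x) $ i) holomorphic_on S" for i
      using exhaust_3[of i]
      by (elim disjE; hypsubst; unfold ccross_components; intro holomorphic_intros u[rule_format] v[rule_format])
    have "(\<lambda>x. cdot (u x) (v x)) holomorphic_on S"
      unfolding cdot_def using u v by (intro holomorphic_intros) auto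
    then have "(\<lambda>x. cnormal (u x) (v x) $ i) holomorphic_on S" for i
      unfolding cnormal_def vector_smult_component
      by (intro holomorphic_intros cr) (use V in \<open>auto simp: V_def\<close>)
    then have "(\<lambda>x. G (cnormal (u x) (v x))) holomorphic_on S"
      by (intro VG(5)[rule_format] S) (use V in \<open>auto simp: V_def\<close>)
    then show "(\<lambda>x. F (u x, v x) $ i) holomorphic_on S"
      unfolding F_def vector_smult_component fst_conv snd_conv by (intro holomorphic_intros cr)
  qed
  \<comment> \<open>The conditions on Bjoerling data are conformality along the curve, so the
    initial normal is a unit vector and lies in \<open>U\<close>.\<close>
  have p0V: "(p0 (of_real s), vcnj (p0 (of_real s))) \<in> V" if s: "s \<in> I" for s
  proof -
    have E: "re2 (p0 (of_real s)) \<bullet> re2 (p0 (of_real s)) = im2 (p0 (of_real s)) \<bullet> im2 (p0 (of_real s))"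
      "re2 (p0 (of_real s)) \<bullet> im2 (p0 (of_real s)) = 0" "re2 (p0 (of_real s)) \<bullet> re2 (p0 (of_real s)) > 0"
      unfolding vd(2,3)[OF s] using bj s by (auto simp: bjorling_data_def norm_eq)
    have "rnormal (p0 (of_real s)) \<in> U"
      using norm_rnormal[OF E] g(2) by (auto simp: sphere2_def)
    moreover have "cdot (p0 (of_real s)) (vcnj (p0 (of_real s))) \<noteq> 0"
      unfolding cdot_vcnj of_real_eq_0_iff using E by simp
    ultimately show ?thesis using VG(2) by (simp add: V_def cnormal_vcnj)
  qed
  have N12: "complex_of_real ` I \<subseteq> N1 \<inter> N2" using N1(2) N2(2) by blast
  obtain \<rho> p a where \<rho>: "\<And>s. s \<in> I \<Longrightarrow> \<rho> s > 0" "\<And>s. s \<in> I \<Longrightarrow> {s - \<rho> s<..<s + \<rho> s} \<subseteq> I"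
    and pV: "\<And>s z. s \<in> I \<Longrightarrow> z \<in> sq s (\<rho> s) \<Longrightarrow> (p z, vcnj (p z)) \<in> V"
    and dp: "\<And>s z i. s \<in> I \<Longrightarrow> z \<in> sq s (\<rho> s) \<Longrightarrow> ((\<lambda>z. p z $ i) has_derivative
       (\<lambda>h. a z $ i * h + F (p z, vcnj (p z)) $ i * cnj h)) (at z)"
    and conta: "\<And>s i. s \<in> I \<Longrightarrow> continuous_on (sq s (\<rho> s)) (\<lambda>z. a z $ i)"
    and pI: "\<And>s. s \<in> I \<Longrightarrow> p (of_real s) = p0 (of_real s)"
  proof (rule Cauchy_Kovalevskaya_dbar[OF oV contF holF open_Int[OF N1(1) N2(1)] N12 p0_hol I p0V], goal_cases)
    case (2 \<rho> p a)
    then show ?case by (intro that[of \<rho> p a])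
  qed
  define k where "k z = curvature_term g (p z)" for z
  \<comment> \<open>The factors \<open>- \<i>\<close> and \<open>\<i> / 2\<close> multiply to 1/2,
    and \<open>G\<close> takes real values at real points: on the antidiagonal the right-hand side
    is a real vector.\<close>
  have Fk: "F (p z, vcnj (p z)) = cvec (k z)" if "s \<in> I" "z \<in> sq s (\<rho> s)" for s z
  proof -
    have "cvec (rnormal (p z)) \<in> VG" using pV[OF that] by (simp add: V_def cnormal_vcnj)
    then show ?thesis
      by (simp add: F_def k_def curvature_term_def cnormal_vcnj ccross_vcnj VG(4)) (simp add: cvec_def vec_eq_iff complex_eq_iff)
  qed
  have dpk: "((\<lambda>z. p z $ i) has_derivative (\<lambda>h. a z $ i * h + of_real (k z $ i) * cnj h)) (at z)"
    if "s \<in> I" "z \<in> sq s (\<rho> s)" for s z i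
    using dp[OF that, of i] Fk[OF that] by (simp add: cvec_def)
  have contp: "continuous_on (sq s (\<rho> s)) (\<lambda>z. p z $ i)" if "s \<in> I" for s i
    by (intro continuous_at_imp_continuous_on ballI has_derivative_continuous[OF dp[OF that]])
  have contk: "continuous_on (sq s (\<rho> s)) (\<lambda>z. k z $ i)" if s: "s \<in> I" for s i
  proof -
    have "continuous_on (sq s (\<rho> s)) p"
      by (rule continuous_on_componentwise_vec[OF contp[OF s]])
    moreover have "continuous_on (sq s (\<rho> s)) (\<lambda>z. vcnj (p z))"
      unfolding vcnj_def by (intro continuous_on_vec_lambda continuous_on_cnj contp[OF s])
    ultimately have "continuous_on (sq s (\<rho> s)) (\<lambda>z. F (p z, vcnj (p z)) $ i)"
      by (rule continuous_on_compose2[OF contF continuous_on_Pair]) (use pV[OF s] in auto)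
    then have "continuous_on (sq s (\<rho> s)) (\<lambda>z. Re (F (p z, vcnj (p z)) $ i))"
      by (rule continuous_on_Re)
    then show ?thesis by (rule continuous_on_eq) (simp add: Fk[OF s] cvec_def)
  qed
  define \<psi> where "\<psi> z = \<beta> (Re z) + integral {0..1} (\<lambda>\<sigma>. Im z *\<^sub>R im2 (p (Complex (Re z) (\<sigma> * Im z))))" for z
  have d\<psi>: "(\<psi> has_derivative (\<lambda>h. Re h *\<^sub>R re2 (p z) + Im h *\<^sub>R im2 (p z))) (at z)"
    if s: "s \<in> I" and z: "z \<in> sq s (\<rho> s)" for s z
    unfolding \<psi>_def
  \<comment> \<open>The form is closed because the curvature term is real: one and the same
    \<open>Xt\<close> is the \<open>t\<close>-derivative of \<open>re2 p\<close> and the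
    \<open>s\<close>-derivative of \<open>im2 p\<close>.\<close>
  proof (rule potential_on_square[where X = "\<lambda>z. re2 (p z)" and Y = "\<lambda>z. im2 (p z)" and
        Xs = "\<lambda>z. \<chi> i. 2 * Re (a z $ i) + 2 * k z $ i" and Xt = "\<lambda>z. \<chi> i. - 2 * Im (a z $ i)" and
        Yt = "\<lambda>z. \<chi> i. - 2 * Re (a z $ i) + 2 * k z $ i", OF _ _ _ _ _ z])
    show "((\<lambda>z. re2 (p z)) has_derivative
        (\<lambda>h. Re h *\<^sub>R (\<chi> i. 2 * Re (a z $ i) + 2 * k z $ i) + Im h *\<^sub>R (\<chi> i. - 2 * Im (a z $ i)))) (at z)"
      if z: "z \<in> sq s (\<rho> s)" for z
      by (rule has_derivative_vec_componentwise)
         (auto simp: re2_def algebra_simps intro!: derivative_eq_intros dpk[OF s z])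
    show "((\<lambda>z. im2 (p z)) has_derivative
        (\<lambda>h. Re h *\<^sub>R (\<chi> i. - 2 * Im (a z $ i)) + Im h *\<^sub>R (\<chi> i. - 2 * Re (a z $ i) + 2 * k z $ i))) (at z)"
      if z: "z \<in> sq s (\<rho> s)" for z
      by (rule has_derivative_vec_componentwise)
         (auto simp: im2_def algebra_simps intro!: derivative_eq_intros dpk[OF s z])
    show "continuous_on (sq s (\<rho> s)) (\<lambda>z. \<chi> i. - 2 * Im (a z $ i))"
      "continuous_on (sq s (\<rho> s)) (\<lambda>z. \<chi> i. - 2 * Re (a z $ i) + 2 * k z $ i)"
      by (intro continuous_on_vec_lambda continuous_intros conta[OF s] contk[OF s])+
    show "(\<beta> has_vector_derivative re2 (p (of_real x))) (at x)" if "x \<in> {s - \<rho> s<..<s + \<rho> s}" for x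
    proof -
      have "x \<in> I" using \<rho>(2)[OF s] that by blast
      then show ?thesis using vd pI by simp
    qed
  qed
  show ?thesis
  proof (rule that[OF \<rho> d\<psi> dpk[unfolded k_def] conta contk[unfolded k_def]])
    show "re2 (p z) \<bullet> re2 (p z) + im2 (p z) \<bullet> im2 (p z) > 0" if "s \<in> I" "z \<in> sq s (\<rho> s)" for s z
    proof -
      have "cdot (p z) (vcnj (p z)) \<noteq> 0" using pV[OF that] by (simp add: V_def)
      then have "re2 (p z) \<bullet> re2 (p z) + im2 (p z) \<bullet> im2 (p z) \<noteq> 0"
        unfolding cdot_vcnj of_real_eq_0_iff by simp
      moreover have "re2 (p z) \<bullet> re2 (p z) + im2 (p z) \<bullet> im2 (p z) \<ge> 0"
        by (intro add_nonneg_nonneg inner_ge_zero)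
      ultimately show ?thesis by linarith
    qed
    show "\<psi> (of_real s) = \<beta> s" for s by (simp add: \<psi>_def)
    show "re2 (p (of_real s)) = vector_derivative \<beta> (at s)" "im2 (p (of_real s)) = B s" if "s \<in> I" for s
      using vd[OF that] pI[OF that] by simp_all
  qed
qed

section \<open>Conformality of the solution and its geometric consequences\<close>

theorem mainTheorem1:
  fixes H :: "real^3 \<Rightarrow> real"
    and I :: "real set"
    and \<beta> B :: "real \<Rightarrow> real^3"
  assumes "analytic_on_S2 H"
    and "open I" and "is_interval I" and "I \<noteq> {}"
    and "bjorling_data I \<beta> B"
  shows "\<exists>\<Omega> (\<psi> :: complex \<Rightarrow> real^3).
           open \<Omega> \<and> connected \<Omega> \<and> complex_of_real ` I \<subseteq> \<Omega> \<and>
           conformal_immersion_on \<Omega> \<psi> \<and>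
           (\<forall>z\<in>\<Omega>. wz (wzb (cvec \<circ> \<psi>)) z =
                    (- \<i> * complex_of_real (H (unit_normal \<psi> z))) *s
                      ccross (wz (cvec \<circ> \<psi>) z) (wzb (cvec \<circ> \<psi>) z)) \<and>
           (\<forall>s\<in>I. \<psi> (complex_of_real s) = \<beta> s \<and> d_t \<psi> (complex_of_real s) = B s) \<and>
           (\<forall>z\<in>\<Omega>. norm (unit_normal \<psi> z) = 1 \<and>
                    unit_normal \<psi> z \<bullet> d_s \<psi> z = 0 \<and> unit_normal \<psi> z \<bullet> d_t \<psi> z = 0 \<and>
                    mean_curvature \<psi> (unit_normal \<psi>) z = H (unit_normal \<psi> z)) \<and>
           (\<forall>s\<in>I. span {d_s \<psi> (complex_of_real s), d_t \<psi> (complex_of_real s)} =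
                   span {vector_derivative \<beta> (at s), B s})"
proof -
  obtain U g where g: "real_analytic_on3 U g" "sphere2 \<subseteq> U" "\<And>p. p \<in> sphere2 \<Longrightarrow> g p = H p"
    using assms(1) by (auto simp: analytic_on_S2_def)
  obtain \<rho> \<psi> p a where \<rho>: "\<And>s. s \<in> I \<Longrightarrow> \<rho> s > 0" "\<And>s. s \<in> I \<Longrightarrow> {s - \<rho> s<..<s + \<rho> s} \<subseteq> I"
    and d\<psi>': "\<And>s z. s \<in> I \<Longrightarrow> z \<in> sq s (\<rho> s) \<Longrightarrow>
       (\<psi> has_derivative (\<lambda>h. Re h *\<^sub>R re2 (p z) + Im h *\<^sub>R im2 (p z))) (at z)"
    and dp': "\<And>s z i. s \<in> I \<Longrightarrow> z \<in> sq s (\<rho> s) \<Longrightarrow> ((\<lambda>z. p z $ i) has_derivative (\<lambda>h. a z $ i * h +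
       of_real (curvature_term g (p z) $ i) * cnj h)) (at z)"
    and conta': "\<And>s i. s \<in> I \<Longrightarrow> continuous_on (sq s (\<rho> s)) (\<lambda>z. a z $ i)"
    and contk': "\<And>s i. s \<in> I \<Longrightarrow> continuous_on (sq s (\<rho> s)) (\<lambda>z. curvature_term g (p z) $ i)"
    and ppos': "\<And>s z. s \<in> I \<Longrightarrow> z \<in> sq s (\<rho> s) \<Longrightarrow> re2 (p z) \<bullet> re2 (p z) + im2 (p z) \<bullet> im2 (p z) > 0"
    and \<psi>I: "\<And>s. s \<in> I \<Longrightarrow> \<psi> (of_real s) = \<beta> s"
    and XI: "\<And>s. s \<in> I \<Longrightarrow> re2 (p (of_real s)) = vector_derivative \<beta> (at s)"
    and YI: "\<And>s. s \<in> I \<Longrightarrow> im2 (p (of_real s)) = B s"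
  proof (rule bjorling_surface[OF g(1,2) assms(2,5)], goal_cases)
    case (1 \<rho> \<psi> p a)
    then show ?case by (intro that[of \<rho> \<psi> p a])
  qed
  define \<Omega> where "\<Omega> = (\<Union>s\<in>I. sq s (\<rho> s))"
  have I\<Omega>: "of_real s \<in> sq s (\<rho> s)" "complex_of_real s \<in> \<Omega>" if "s \<in> I" for s
    using that \<rho>(1)[OF that] by (auto simp: \<Omega>_def sq_def intro!: bexI[of _ s])
  have o\<Omega>: "open \<Omega>" unfolding \<Omega>_def by (intro open_UN ballI open_sq)
  have conn: "connected \<Omega>"
  proof -
    have cI: "connected (complex_of_real ` I)"
      using assms(3) by (intro connected_continuous_image continuous_intros) (simp add: is_interval_connected)
    \<comment> \<open>Adding the whole real segment to every square leaves the union unchanged and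
      gives all pieces a common point.\<close>
    have "\<Omega> = (\<Union>s\<in>I. sq s (\<rho> s) \<union> complex_of_real ` I)"
      using I\<Omega> assms(4) by (auto simp: \<Omega>_def)
    moreover have "connected (\<Union>s\<in>I. sq s (\<rho> s) \<union> complex_of_real ` I)"
    proof (rule connected_Union)
      fix S assume "S \<in> (\<lambda>s. sq s (\<rho> s) \<union> complex_of_real ` I) ` I"
      then obtain s where s: "s \<in> I" and S: "S = sq s (\<rho> s) \<union> complex_of_real ` I" by blast
      have "sq s (\<rho> s) \<inter> complex_of_real ` I \<noteq> {}" using I\<Omega>(1)[OF s] s by blast
      then show "connected S"
        unfolding S by (rule connected_Un[OF convex_connected[OF convex_sq] cI])
    next
      show "\<Inter> ((\<lambda>s. sq s (\<rho> s) \<union> complex_of_real ` I) ` I) \<noteq> {}" using assms(4) by blast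
    qed
    ultimately show ?thesis by simp
  qed
  have d\<psi>: "(\<psi> has_derivative (\<lambda>h. Re h *\<^sub>R re2 (p z) + Im h *\<^sub>R im2 (p z))) (at z)"
    and dp: "((\<lambda>z. p z $ i) has_derivative (\<lambda>h. a z $ i * h + of_real (curvature_term g (p z) $ i) * cnj h)) (at z)"
    and ppos: "re2 (p z) \<bullet> re2 (p z) + im2 (p z) \<bullet> im2 (p z) > 0" if "z \<in> \<Omega>" for z i
    using that d\<psi>' dp' ppos' by (auto simp: \<Omega>_def)
  have conta: "continuous_on \<Omega> (\<lambda>z. a z $ i)" and contk: "continuous_on \<Omega> (\<lambda>z. curvature_term g (p z) $ i)" for i
    unfolding \<Omega>_def by (intro continuous_on_open_UN open_sq conta' contk'; assumption)+
  note sc = surface_calculus[OF o\<Omega> _ d\<psi> dp]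
  text \<open>The Hopf differential is holomorphic, because the mixed derivative of \<open>\<psi>\<close> is orthogonal to
    \<open>\<psi>\<^sub>z\<close>, and it vanishes on the curve; hence \<open>\<psi>\<close> is conformal.\<close>
  have "cdot (p z) (p z) = 0" if z: "z \<in> \<Omega>" for z
  proof -
    obtain s0 where s0: "s0 \<in> I" using assms(4) by blast
    obtain e where e: "e > 0" "ball s0 e \<subseteq> I"
      using assms(2) s0 open_contains_ball by blast
    have hol: "(\<lambda>z. cdot (p z) (p z)) holomorphic_on \<Omega>"
      unfolding holomorphic_on_open[OF o\<Omega>]
    proof
      fix z assume z: "z \<in> \<Omega>"
      have "p z $ 1 * of_real (curvature_term g (p z) $ 1) + p z $ 2 * of_real (curvature_term g (p z) $ 2) + p z $ 3 * of_real (curvature_term g (p z) $ 3) = 0"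
        by (simp add: curvature_term_def cross_components re2_def im2_def complex_eq_iff algebra_simps)
      then have k0: "p z $ 1 * (of_real (curvature_term g (p z) $ 1) * y) + (p z $ 2 * (of_real (curvature_term g (p z) $ 2) * y) +
          p z $ 3 * (of_real (curvature_term g (p z) $ 3) * y)) = 0" for y
        by (metis (no_types, lifting) add.assoc distrib_right mult.assoc mult_zero_left)
      have "((\<lambda>z. cdot (p z) (p z)) has_derivative (\<lambda>h. 2 * cdot (p z) (a z) * h)) (at z)"
        unfolding cdot_def
        by (rule derivative_eq_intros refl dp[OF z])+ (use k0[of "2 * cnj h" for h] in \<open>simp add: fun_eq_iff algebra_simps\<close>)
      then show "\<exists>f'. ((\<lambda>z. cdot (p z) (p z)) has_field_derivative f') (at z)"
        unfolding has_field_derivative_def by blast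
    qed
    show ?thesis
    proof (rule holomorphic_eq_if_eq_on_reals[OF o\<Omega> conn hol holomorphic_on_const I\<Omega>(2)[OF s0] z e(1)])
      fix x assume "\<bar>x - s0\<bar> < e"
      then have x: "x \<in> I" using e(2) by (auto simp: dist_norm abs_minus_commute subset_iff)
      then have "norm (vector_derivative \<beta> (at x)) = norm (B x)" "vector_derivative \<beta> (at x) \<bullet> B x = 0"
        using assms(5) by (auto simp: bjorling_data_def)
      then show "cdot (p (of_real x)) (p (of_real x)) = 0"
        by (simp add: cdot_self XI[OF x] YI[OF x] norm_eq complex_eq_iff)
    qed
  qed
  then have conf: "re2 (p z) \<bullet> re2 (p z) = im2 (p z) \<bullet> im2 (p z)" "re2 (p z) \<bullet> im2 (p z) = 0"
    "re2 (p z) \<bullet> re2 (p z) > 0" if "z \<in> \<Omega>" for z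
    using that ppos[OF that] by (auto simp: cdot_self complex_eq_iff)
  have normal: "unit_normal \<psi> z = rnormal (p z)" if z: "z \<in> \<Omega>" for z
  proof -
    \<comment> \<open>In the conformal case \<open>cdot p (vcnj p)\<close> is half of the conformal
      factor.\<close>
    have "2 / (\<i> * complex_of_real (conf_factor \<psi> z)) = 1 / (\<i> * cdot (p z) (vcnj (p z)))"
      using conf[OF z] by (simp add: conf_factor_def sc(1)[OF z] cdot_vcnj field_simps)
    then have "unit_normal \<psi> z = rvec (cnormal (p z) (vcnj (p z)))"
      by (simp add: unit_normal_def sc(3,4)[OF z] cnormal_def)
    then show ?thesis by (simp add: cnormal_vcnj rvec_def cvec_def)
  qed
  have nn: "norm (rnormal (p z)) = 1" if "z \<in> \<Omega>" for z
    using norm_rnormal[OF conf[OF that]] .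
  \<comment> \<open>The extension \<open>g\<close> agrees with \<open>H\<close> on the sphere only;
    the unit length gained from conformality is what brings \<open>H\<close> back.\<close>
  have gH: "g (rnormal (p z)) = H (rnormal (p z))" if "z \<in> \<Omega>" for z
    using nn[OF that] by (intro g(3)) (simp add: sphere2_def)
  have cross: "cross3 (re2 (p z)) (im2 (p z)) = (re2 (p z) \<bullet> re2 (p z)) *\<^sub>R rnormal (p z)" if "z \<in> \<Omega>" for z
    using conf[OF that] by (simp add: rnormal_def)
  show ?thesis
  proof (intro exI[of _ \<Omega>] exI[of _ \<psi>] conjI ballI)
    show "open \<Omega>" "connected \<Omega>" by fact+
    show "complex_of_real ` I \<subseteq> \<Omega>" using I\<Omega> by auto
    show "conformal_immersion_on \<Omega> \<psi>"
      unfolding conformal_immersion_on_def C2_on_def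
    proof (intro conjI ballI)
      show "\<psi> differentiable (at z)" if "z \<in> \<Omega>" for z
        using d\<psi>[OF that] unfolding differentiable_def by blast
      show "d_s \<psi> differentiable (at z)" "d_t \<psi> differentiable (at z)" if "z \<in> \<Omega>" for z
        using sc(6,7)[OF that] by simp_all
      show "continuous_on \<Omega> (d_s (d_s \<psi>))"
        by (rule continuous_on_eq[OF _ sc(8)[symmetric]], intro continuous_on_vec_lambda continuous_intros conta contk)
      show "continuous_on \<Omega> (d_s (d_t \<psi>))"
        by (rule continuous_on_eq[OF _ sc(9)[symmetric]], intro continuous_on_vec_lambda continuous_intros conta contk)
      show "continuous_on \<Omega> (d_t (d_s \<psi>))"
        by (rule continuous_on_eq[OF _ sc(10)[symmetric]], intro continuous_on_vec_lambda continuous_intros conta contk)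
      show "continuous_on \<Omega> (d_t (d_t \<psi>))"
        by (rule continuous_on_eq[OF _ sc(11)[symmetric]], intro continuous_on_vec_lambda continuous_intros conta contk)
      show "d_s \<psi> z \<bullet> d_s \<psi> z = d_t \<psi> z \<bullet> d_t \<psi> z" "d_s \<psi> z \<bullet> d_t \<psi> z = 0" "d_s \<psi> z \<bullet> d_s \<psi> z > 0"
        if "z \<in> \<Omega>" for z
        using conf[OF that] by (simp_all add: sc(1,2)[OF that])
    qed
  next
    fix z assume z: "z \<in> \<Omega>"
    let ?n = "rnormal (p z)" and ?E = "re2 (p z) \<bullet> re2 (p z)"
    show "wz (wzb (cvec \<circ> \<psi>)) z = (- \<i> * complex_of_real (H (unit_normal \<psi> z))) *s
        ccross (wz (cvec \<circ> \<psi>) z) (wzb (cvec \<circ> \<psi>) z)"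
      by (simp add: sc(3-5)[OF z] normal[OF z] ccross_vcnj curvature_term_def gH[OF z])
         (simp add: cvec_def vec_eq_iff complex_eq_iff)
    show "norm (unit_normal \<psi> z) = 1" using normal[OF z] nn[OF z] by simp
    show "unit_normal \<psi> z \<bullet> d_s \<psi> z = 0" "unit_normal \<psi> z \<bullet> d_t \<psi> z = 0"
      by (simp_all add: normal[OF z] sc(1,2)[OF z] rnormal_def dot_cross_self inner_commute)
    \<comment> \<open>The Laplacian is four times the mixed Wirtinger derivative: the contributions
      of \<open>a\<close> cancel.\<close>
    have "(d_s (d_s \<psi>) z + d_t (d_t \<psi>) z) = 4 *\<^sub>R curvature_term g (p z)"
      by (simp add: sc(8,11)[OF z] vec_eq_iff)
    then have "(d_s (d_s \<psi>) z \<bullet> ?n) + (d_t (d_t \<psi>) z \<bullet> ?n) = 2 * H ?n * ?E"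
      using nn[OF z] unfolding inner_add_left[symmetric]
      by (simp add: curvature_term_def cross[OF z] gH[OF z] norm_eq_1)
    \<comment> \<open>Multiplied by \<open>?E\<close>, the left-hand side is the numerator of the
      mean curvature for \<open>E = G\<close> and \<open>F = 0\<close>; the denominator is then
      \<open>2 * ?E * ?E\<close>.\<close>
    then have "d_s (d_s \<psi>) z \<bullet> ?n * ?E + d_t (d_t \<psi>) z \<bullet> ?n * ?E = 2 * H ?n * ?E * ?E"
      by (simp flip: distrib_right)
    then show "mean_curvature \<psi> (unit_normal \<psi>) z = H (unit_normal \<psi> z)"
      using conf[OF z]
      by (simp add: mean_curvature_def normal[OF z] sc(1,2)[OF z] power2_eq_square)
  next
    fix s assume s: "s \<in> I"
    show "\<psi> (complex_of_real s) = \<beta> s" using \<psi>I[OF s] .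
    show "d_t \<psi> (complex_of_real s) = B s" using sc(2)[OF I\<Omega>(2)[OF s]] YI[OF s] by simp
    show "span {d_s \<psi> (complex_of_real s), d_t \<psi> (complex_of_real s)} = span {vector_derivative \<beta> (at s), B s}"
      using sc(1,2)[OF I\<Omega>(2)[OF s]] XI[OF s] YI[OF s] by simp
  qed
qed

end
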